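(* Let $(X,Y,\mu)$ be an integrable $(G,H)$-transverse system with $H$-transverse measure $\sigma$, let $\xi:H\to\mathbb T$ be a unitary character, and let $\psi_\xi:Y\to\mathbb C$ be an $H$-eigenfunction of $Y$ with eigencharacter $\xi$, i.e. a non-zero bounded Borel function with $\psi_\xi(h^{-1}.y)=\xi(h)\psi_\xi(y)$ for all $h\in H$, $y\in Y$. (i) There is a well-defined $G$-equivariant linear map $$S_{\psi_\xi}:{}^0\mathrm{Ind}_H^G(\xi)\to L^1(X,\mu),\qquad S_{\psi_\xi}f(x)=\sum_{Hg\in Y_x}f(g)\,\psi_\xi(g.x).$$ (ii) If $\phi\in\mathcal L^\infty(X)$, then $S^*_{\psi_\xi}\phi(g):=\int_Y\phi(g^{-1}.y)\,\overline{\psi_\xi(y)}\,d\sigma(y)$ is a bounded Borel function on $G$. (iii) If $f\in{}^0\mathrm{Ind}_H^G(\xi)$ and $\phi\in\mathcal L^\infty(X)$, then $f\cdot\overline{S^*_{\psi_\xi}\phi}$ descends to an integrable function on $H\backslash G$ and $$\int_X S_{\psi_\xi}f\cdot\overline{\phi}\,d\mu=\int_{H\backslash G}f\cdot\overline{S^*_{\psi_\xi}\phi}\,dm_{H\backslash G}.$$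
   Context: $G$ is a unimodular lcsc group and $H<G$ a closed unimodular subgroup, with Haar measures $m_G,m_H$ and the $G$-invariant measure $m_{H\backslash G}$ normalized by $\int_G f\,dm_G=\int_{H\backslash G}\int_H f(hg)\,dm_H(h)\,dm_{H\backslash G}(Hg)$. $X$ is a standard Borel $G$-space. A $(G,H)$-cross section is a Borel subset $Y\subset X$ with $G.Y=X$ and $H.Y=Y$; hitting time sets are $Y_x=\{Hg\in H\backslash G\mid g.x\in Y\}$. If $\mu$ is a $G$-invariant Borel probability measure on $X$, then $(X,Y,\mu)$ is a $(G,H)$-transverse system; it is integrable if $\int_X|Y_x\cap L|\,d\mu(x)<\infty$ for every compact $L\subset H\backslash G$. The $H$-transverse measure $\sigma$ is the unique finite $H$-invariant Borel measure on $Y$ with $$\int_X\sum_{Hg\in Y_x}\int_H F((hg)^{-1},hg.x)\,dm_H(h)\,d\mu(x)=\int_G\int_Y F(g,y)\,d\sigma(y)\,dm_G(g)$$ for all bounded Borel $F$ on $G\times Y$ vanishing outside $L\times Y$ for some compact $L\subset G$. $\mathcal L^\infty(X)$ is the space of bounded Borel functions on $X$. ${}^0\mathrm{Ind}_H^G(\xi)$ is the space of $f\in C(G)$ with $f(hg)=\xi(h)f(g)$ for all $h\in H,g\in G$ such that $|f|$, viewed as a function on $H\backslash G$, is in $C_c(H\backslash G)$. $G$ acts on it by $(g.f)(x)=f(xg)$ and on functions on $X$ by $(g.\phi)(x)=\phi(g^{-1}.x)$. *)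

theory Defs
  imports "HOL-Probability.Probability"
begin

text \<open>
  The ambient group is a type of class \<^class>\<open>topological_group_add\<close>. It is written additively, but
  \<^class>\<open>group_add\<close> does not include commutativity: \<open>g + h\<close> is the product \<open>gh\<close>, \<open>- g\<close> the
  inverse, \<open>0\<close> the identity. Second countability and the Hausdorff property are sort constraints.
\<close>

section \<open>Subgroups and right cosets\<close>

definition add_subgroup :: "'g::group_add set \<Rightarrow> bool" where
  "add_subgroup H \<longleftrightarrow> 0 \<in> H \<and> (\<forall>x\<in>H. \<forall>y\<in>H. x + y \<in> H) \<and> (\<forall>x\<in>H. - x \<in> H)"

text \<open>The coset \<open>Hg\<close> and the set \<open>H\G\<close>.\<close>

definition right_coset :: "'g::group_add set \<Rightarrow> 'g \<Rightarrow> 'g set" where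
  "right_coset H g = (\<lambda>h. h + g) ` H"

definition right_cosets :: "'g::group_add set \<Rightarrow> 'g set set" where
  "right_cosets H = range (right_coset H)"

text \<open>The common value of \<open>u\<close> on the coset \<open>c\<close>; unspecified if \<open>u\<close> is not constant on \<open>c\<close>.\<close>

definition on_coset :: "('g \<Rightarrow> 'a) \<Rightarrow> 'g set \<Rightarrow> 'a" where
  "on_coset u c = (THE v. \<forall>g\<in>c. u g = v)"

lemma on_coset_right_coset:
  assumes "add_subgroup H" and "\<And>h. h \<in> H \<Longrightarrow> u (h + g) = u g"
  shows "on_coset u (right_coset H g) = u g"
proof -
  have "0 \<in> H" using assms(1) by (simp add: add_subgroup_def)
  then have "g \<in> right_coset H g" unfolding right_coset_def by force
  then show ?thesis
    unfolding on_coset_def using assms(2)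
    by (intro the_equality) (auto simp: right_coset_def)
qed

text \<open>The quotient topology on \<open>H\G\<close>.\<close>

definition coset_topology :: "'g::{topological_space, group_add} set \<Rightarrow> 'g set topology" where
  "coset_topology H = topology (\<lambda>U. U \<subseteq> right_cosets H \<and> open (right_coset H -` U))"

lemma openin_coset_topology:
  "openin (coset_topology H) U \<longleftrightarrow> U \<subseteq> right_cosets H \<and> open (right_coset H -` U)"
proof -
  have "istopology (\<lambda>U. U \<subseteq> right_cosets H \<and> open (right_coset H -` U))"
    unfolding istopology_def by (auto simp: vimage_Union vimage_Int)
  then show ?thesis
    by (simp add: coset_topology_def)
qed

lemma topspace_coset_topology: "topspace (coset_topology H) = right_cosets H"
proof -
  have "right_coset H -` right_cosets H = UNIV"
    by (auto simp: right_cosets_def)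
  then have "openin (coset_topology H) (right_cosets H)"
    by (simp add: openin_coset_topology)
  then show ?thesis
    by (metis openin_coset_topology openin_subset openin_topspace subset_antisym)
qed

definition borel_sets_of :: "'a topology \<Rightarrow> 'a set set" where
  "borel_sets_of T = sigma_sets (topspace T) {U. openin T U}"

definition Cc :: "'a topology \<Rightarrow> ('a \<Rightarrow> 'b::real_normed_vector) set" where
  "Cc T = {u. continuous_map T euclidean u \<and>
              (\<exists>K. compactin T K \<and> (\<forall>x \<in> topspace T - K. u x = 0))}"

section \<open>Haar measures\<close>

text \<open>
  Left Haar measures of a closed subgroup \<open>H\<close>, as measures on the Borel sets of \<open>H\<close>; \<open>H = UNIV\<close> is
  the whole group. In second countable locally compact groups a Borel measure that is finite on
  compact sets is regular, so regularity is not listed.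
\<close>

definition haar_measure :: "'g::topological_group_add set \<Rightarrow> 'g measure \<Rightarrow> bool" where
  "haar_measure H m \<longleftrightarrow>
     sets m = sets (restrict_space borel H) \<and>
     emeasure m H \<noteq> 0 \<and>
     (\<forall>K. compact K \<and> K \<subseteq> H \<longrightarrow> emeasure m K < \<infinity>) \<and>
     (\<forall>h\<in>H. distr m m (\<lambda>x. h + x) = m)"

definition unimodular :: "'g::topological_group_add set \<Rightarrow> bool" where
  "unimodular H \<longleftrightarrow> (\<forall>m. haar_measure H m \<longrightarrow> (\<forall>h\<in>H. distr m m (\<lambda>x. x + h) = m))"

text \<open>
  The invariant measure on \<open>H\G\<close> normalized by the quotient integral formula relative to the Haar
  measures \<open>mG\<close> and \<open>mH\<close>.
\<close>

definition quotient_haar_measure ::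
  "'g::topological_group_add set \<Rightarrow> 'g measure \<Rightarrow> 'g measure \<Rightarrow> 'g set measure \<Rightarrow> bool" where
  "quotient_haar_measure H mG mH m \<longleftrightarrow>
     space m = right_cosets H \<and>
     sets m = borel_sets_of (coset_topology H) \<and>
     (\<forall>K. compactin (coset_topology H) K \<longrightarrow> emeasure m K < \<infinity>) \<and>
     (\<forall>g. distr m m (\<lambda>c. (\<lambda>x. x + g) ` c) = m) \<and>
     (\<forall>f::'g \<Rightarrow> complex. f \<in> Cc euclidean \<longrightarrow>
        (\<integral>g. f g \<partial>mG) = (\<integral>c. on_coset (\<lambda>g. \<integral>h. f (h + g) \<partial>mH) c \<partial>m))"

section \<open>Transverse systems\<close>

definition standard_borel :: "'x measure \<Rightarrow> bool" where
  "standard_borel M \<longleftrightarrow>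
     (\<exists>T. completely_metrizable_space T \<and> second_countable T \<and>
          topspace T = space M \<and> sets M = borel_sets_of T)"

text \<open>In the type \<open>'x measure\<close>, \<open>M\<close> only serves as a measurable space here.\<close>

definition standard_borel_G_space ::
  "'x measure \<Rightarrow> ('g::topological_group_add \<Rightarrow> 'x \<Rightarrow> 'x) \<Rightarrow> bool" where
  "standard_borel_G_space M act \<longleftrightarrow>
     standard_borel M \<and>
     (\<lambda>(g, x). act g x) \<in> borel \<Otimes>\<^sub>M M \<rightarrow>\<^sub>M M \<and>
     (\<forall>x\<in>space M. act 0 x = x) \<and>
     (\<forall>g h. \<forall>x\<in>space M. act (g + h) x = act g (act h x))"

definition cross_section ::
  "'x measure \<Rightarrow> ('g \<Rightarrow> 'x \<Rightarrow> 'x) \<Rightarrow> 'g set \<Rightarrow> 'x set \<Rightarrow> bool" where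
  "cross_section M act H Y \<longleftrightarrow>
     Y \<in> sets M \<and> (\<Union>g. act g ` Y) = space M \<and> (\<Union>h\<in>H. act h ` Y) = Y"

definition hitting_times ::
  "('g::group_add \<Rightarrow> 'x \<Rightarrow> 'x) \<Rightarrow> 'g set \<Rightarrow> 'x set \<Rightarrow> 'x \<Rightarrow> 'g set set" where
  "hitting_times act H Y x = {right_coset H g | g. act g x \<in> Y}"

definition transverse_system ::
  "'x measure \<Rightarrow> ('g::topological_group_add \<Rightarrow> 'x \<Rightarrow> 'x) \<Rightarrow> 'g set \<Rightarrow> 'x set \<Rightarrow> 'x measure \<Rightarrow> bool" where
  "transverse_system M act H Y \<mu> \<longleftrightarrow>
     standard_borel_G_space M act \<and> cross_section M act H Y \<and>
     prob_space \<mu> \<and> sets \<mu> = sets M \<and> (\<forall>g. distr \<mu> \<mu> (act g) = \<mu>)"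

text \<open>
  Functions such as \<open>x \<mapsto> |Y\<^sub>x \<inter> L|\<close> have analytic superlevel sets, so they are in general only
  universally measurable; hence integrals over \<open>X\<close> are taken with respect to the completion of \<open>\<mu>\<close>.
  The measurability conjunct below is then automatic for standard Borel \<open>X\<close>. It is spelled out
  because \<^const>\<open>nn_integral\<close> is a lower integral on nonmeasurable functions.
\<close>

definition integrable_transverse_system ::
  "'x measure \<Rightarrow> ('g::topological_group_add \<Rightarrow> 'x \<Rightarrow> 'x) \<Rightarrow> 'g set \<Rightarrow> 'x set \<Rightarrow> 'x measure \<Rightarrow> bool" where
  "integrable_transverse_system M act H Y \<mu> \<longleftrightarrow>
     transverse_system M act H Y \<mu> \<and>
     (\<forall>L. compactin (coset_topology H) L \<longrightarrow>
        (\<lambda>x. emeasure (count_space UNIV) (hitting_times act H Y x \<inter> L))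
           \<in> borel_measurable (completion \<mu>) \<and>
        (\<integral>\<^sup>+x. emeasure (count_space UNIV) (hitting_times act H Y x \<inter> L) \<partial>completion \<mu>) < \<infinity>)"

text \<open>
  The left-hand integral below exists automatically in an integrable system; since the Bochner
  integral of a nonintegrable function is \<open>0\<close> by convention, existence is made explicit. Sums over
  \<open>Y\<^sub>x\<close> are \<^const>\<open>infsum\<close>s; for almost every \<open>x\<close> they have finitely many nonzero terms.
\<close>

definition transverse_sum ::
  "('g::topological_group_add \<Rightarrow> 'x \<Rightarrow> 'x) \<Rightarrow> 'g set \<Rightarrow> 'x set \<Rightarrow> 'g measure \<Rightarrow>
     ('g \<times> 'x \<Rightarrow> complex) \<Rightarrow> 'x \<Rightarrow> complex" where
  "transverse_sum act H Y mH F x =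
     (\<Sum>\<^sub>\<infinity>c\<in>hitting_times act H Y x.
        on_coset (\<lambda>g. \<integral>h. F (- (h + g), act (h + g) x) \<partial>mH) c)"

definition transverse_measure ::
  "'x measure \<Rightarrow> ('g::topological_group_add \<Rightarrow> 'x \<Rightarrow> 'x) \<Rightarrow> 'g set \<Rightarrow> 'x set \<Rightarrow> 'x measure \<Rightarrow>
     'g measure \<Rightarrow> 'g measure \<Rightarrow> 'x measure \<Rightarrow> bool" where
  "transverse_measure M act H Y \<mu> mG mH \<sigma> \<longleftrightarrow>
     sets \<sigma> = sets (restrict_space M Y) \<and> finite_measure \<sigma> \<and>
     (\<forall>h\<in>H. distr \<sigma> \<sigma> (act h) = \<sigma>) \<and>
     (\<forall>F. F \<in> borel_measurable (borel \<Otimes>\<^sub>M restrict_space M Y) \<and>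
          bounded (F ` (UNIV \<times> Y)) \<and>
          (\<exists>L. compact L \<and> (\<forall>g y. g \<notin> L \<and> y \<in> Y \<longrightarrow> F (g, y) = 0)) \<longrightarrow>
        integrable (completion \<mu>) (transverse_sum act H Y mH F) \<and>
        (\<integral>x. transverse_sum act H Y mH F x \<partial>completion \<mu>) =
          (\<integral>g. (\<integral>y. F (g, y) \<partial>\<sigma>) \<partial>mG))"

section \<open>Induced functions, eigenfunctions and the transform\<close>

definition unitary_character :: "'g::topological_group_add set \<Rightarrow> ('g \<Rightarrow> complex) \<Rightarrow> bool" where
  "unitary_character H \<xi> \<longleftrightarrow>
     continuous_on H \<xi> \<and> (\<forall>h\<in>H. cmod (\<xi> h) = 1) \<and> (\<forall>h\<in>H. \<forall>k\<in>H. \<xi> (h + k) = \<xi> h * \<xi> k)"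

definition Ind0 :: "'g::topological_group_add set \<Rightarrow> ('g \<Rightarrow> complex) \<Rightarrow> ('g \<Rightarrow> complex) set" where
  "Ind0 H \<xi> = {f. continuous_on UNIV f \<and> (\<forall>h\<in>H. \<forall>g. f (h + g) = \<xi> h * f g) \<and>
                  on_coset (\<lambda>g. cmod (f g)) \<in> Cc (coset_topology H)}"

definition eigenfunction ::
  "'x measure \<Rightarrow> ('g::group_add \<Rightarrow> 'x \<Rightarrow> 'x) \<Rightarrow> 'g set \<Rightarrow> 'x set \<Rightarrow> ('g \<Rightarrow> complex) \<Rightarrow>
     ('x \<Rightarrow> complex) \<Rightarrow> bool" where
  "eigenfunction M act H Y \<xi> \<psi> \<longleftrightarrow>
     \<psi> \<in> borel_measurable (restrict_space M Y) \<and> bounded (\<psi> ` Y) \<and> (\<exists>y\<in>Y. \<psi> y \<noteq> 0) \<and>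
     (\<forall>h\<in>H. \<forall>y\<in>Y. \<psi> (act (- h) y) = \<xi> h * \<psi> y)"

definition bounded_borel :: "'x measure \<Rightarrow> ('x \<Rightarrow> complex) set" where
  "bounded_borel M = {\<phi>. \<phi> \<in> borel_measurable M \<and> bounded (\<phi> ` space M)}"

definition S_map ::
  "('g::group_add \<Rightarrow> 'x \<Rightarrow> 'x) \<Rightarrow> 'g set \<Rightarrow> 'x set \<Rightarrow> ('x \<Rightarrow> complex) \<Rightarrow> ('g \<Rightarrow> complex) \<Rightarrow>
     'x \<Rightarrow> complex" where
  "S_map act H Y \<psi> f x =
     (\<Sum>\<^sub>\<infinity>c\<in>hitting_times act H Y x. on_coset (\<lambda>g. f g * \<psi> (act g x)) c)"

definition S_adj ::
  "('g::group_add \<Rightarrow> 'x \<Rightarrow> 'x) \<Rightarrow> 'x measure \<Rightarrow> ('x \<Rightarrow> complex) \<Rightarrow> ('x \<Rightarrow> complex) \<Rightarrow> 'g \<Rightarrow> complex" where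
  "S_adj act \<sigma> \<psi> \<phi> g = (\<integral>y. \<phi> (act (- g) y) * cnj (\<psi> y) \<partial>\<sigma>)"

end

theory Submission
  imports Defs
begin

text \<open>
  Unfolding. A Bruhat-type weight \<open>\<rho>\<close> on \<open>G\<close>, with integral 1 along every coset meeting the support of
  \<open>f\<close>, turns the sum \<open>S f \<cdot> \<phi>\<^sup>*\<close> over the hitting times (\<open>\<phi>\<^sup>*\<close> the conjugate of \<open>\<phi>\<close>) into the transverse
  sum of \<open>F(g, y) = \<rho>(g\<inverse>) f(g\<inverse>) \<psi>(y) \<phi>\<^sup>*(g.y)\<close>. The identity defining \<open>\<sigma>\<close> therefore gives integrability
  and evaluates the integral as that of \<open>\<rho> f\<close> times the conjugate of \<open>S\<^sup>*\<phi>\<close> over \<open>G\<close>, once \<open>g\<close> is replaced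
  by \<open>g\<inverse>\<close>; folding the integral over \<open>H\<close> removes \<open>\<rho>\<close>. The product \<open>f\<close> times the conjugate of \<open>S\<^sup>*\<phi>\<close> is only
  Borel, so the quotient integral formula, given for continuous functions of compact support, is
  first extended to all nonnegative Borel functions.
\<close>

section \<open>Topological groups\<close>

text \<open>The support of \<open>f\<close> is compact only modulo H. Without a cut-off along the
  cosets the test function need not vanish outside a compact set, and the identity defining \<sigma>
  would not apply; this is the purpose of \<rho>. Test functions there are bounded Borel, so a
  bounded Borel weight suffices: an indicator divided by its own coset integral.

  Right invariance on H makes integrals along a coset independent of the representative. Right
  invariance on G yields invariance under inversion, which removes the inverses built into the
  definition of \<sigma>.

  The other obstacle is measurability. The sigma-algebra on the coset space is generated by the
  quotient topology, and a Borel function on G descends only once every set of cosets with Borel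
  preimage is known to belong to it. On X, measurability of S f for the completion of \<mu> is never
  attacked directly: it is inherited from the transverse sum, with which S f (times the conjugate of
  \<phi>) agrees at every point.\<close>

lemma borel_measurable_group_uminus [measurable (raw)]:
  fixes f :: "'a \<Rightarrow> 'g::topological_group_add"
  assumes "f \<in> borel_measurable M"
  shows "(\<lambda>x. - f x) \<in> borel_measurable M"
  by (rule borel_measurable_continuous_on[OF _ assms]) (intro continuous_intros)

lemma borel_measurable_cnj [measurable (raw)]:
  fixes f :: "'a \<Rightarrow> complex"
  assumes "f \<in> borel_measurable M"
  shows "(\<lambda>x. cnj (f x)) \<in> borel_measurable M"
  by (rule borel_measurable_continuous_on[OF _ assms]) (intro continuous_intros)

lemma mem_left_translate_iff:
  fixes g :: "'g::group_add"
  shows "x \<in> (+) g ` V \<longleftrightarrow> - g + x \<in> V"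
  by (metis (no_types, lifting) add.assoc add.left_neutral add.right_inverse image_iff left_minus)

lemma open_left_translate:
  fixes V :: "'g::topological_group_add set"
  assumes "open V"
  shows "open ((+) g ` V)"
proof -
  have "(+) g ` V = (\<lambda>x. - g + x) -` V"
    by (auto simp: mem_left_translate_iff)
  then show ?thesis
    by (simp only:) (intro open_vimage assms continuous_intros)
qed

lemma compact_left_translate:
  fixes K :: "'g::topological_group_add set"
  shows "compact K \<Longrightarrow> compact ((+) g ` K)"
  by (intro compact_continuous_image continuous_intros)

lemma compact_set_plus:
  fixes K L :: "'g::topological_group_add set"
  assumes "compact K" "compact L"
  shows "compact ((\<lambda>(x, y). x + y) ` (K \<times> L))"
  unfolding case_prod_beta
  by (intro compact_continuous_image compact_Times assms continuous_intros)

lemma compact_uminus_image: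
  fixes K :: "'g::topological_group_add set"
  shows "compact K \<Longrightarrow> compact (uminus ` K)"
  by (intro compact_continuous_image continuous_intros)

text \<open>If h_n + c_n converges, compactness makes c_n converge along a subsequence; then h_n
  converges along it too, and its limit lies in H. For a subgroup H this makes the union of the
  cosets through a compact set closed.\<close>

lemma closed_plus_compact:
  fixes H C :: "'g::{topological_group_add, first_countable_topology} set"
  assumes "closed H" "compact C"
  shows "closed ((\<lambda>(x, y). x + y) ` (H \<times> C))"
  unfolding closed_sequential_limits
proof (intro allI impI; elim conjE)
  fix s l assume "\<forall>n. s n \<in> (\<lambda>(x, y). x + y) ` (H \<times> C)" and lim: "s \<longlonglongrightarrow> l"
  then have "\<forall>n. \<exists>h c. h \<in> H \<and> c \<in> C \<and> s n = h + c"
    by (fastforce simp: image_iff)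
  then obtain h c where hc: "\<And>n. h n \<in> H" "\<And>n. c n \<in> C" "\<And>n. s n = h n + c n"
    by metis
  obtain l' r where r: "l' \<in> C" "strict_mono r" "(c \<circ> r) \<longlonglongrightarrow> l'"
    using compact_imp_seq_compact[OF assms(2)] hc(2) unfolding seq_compact_def by metis
  have "(\<lambda>n. s (r n) + - c (r n)) \<longlonglongrightarrow> l + - l'"
    using LIMSEQ_subseq_LIMSEQ[OF lim r(2)] r(3) by (intro tendsto_intros) (simp_all add: o_def)
  moreover have "s (r n) + - c (r n) = h (r n)" for n
    by (simp add: hc(3))
  ultimately have "l + - l' \<in> H"
    using closed_sequentially[OF assms(1), of "\<lambda>n. h (r n)"] hc(1) by simp
  moreover have "l = (l + - l') + l'"
    by simp
  ultimately show "l \<in> (\<lambda>(x, y). x + y) ` (H \<times> C)"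
    using r(1) by (intro image_eqI[of _ _ "(l + - l', l')"]) auto
qed

lemma locally_compact_group_nhd:
  assumes "locally_compact_space (euclidean :: 'g::topological_group_add topology)"
  obtains W :: "'g::topological_group_add set" where "compact W" "0 \<in> interior W"
proof -
  obtain U W :: "'g set" where "open U" "compact W" "0 \<in> U" "U \<subseteq> W"
    using assms unfolding locally_compact_space_def
    by (metis UNIV_I compactin_euclidean_iff open_openin topspace_euclidean)
  then show ?thesis
    using that[of W] interiorI by blast
qed

text \<open>Lindelof. The centres are kept inside \<open>A\<close>, because a Haar measure of H is
  only invariant under translations from H.\<close>

lemma countable_translate_cover:
  fixes V :: "'g::{topological_group_add, second_countable_topology} set"
  assumes "open V" "0 \<in> V"
  obtains D where "countable D" "D \<subseteq> A" "A \<subseteq> (\<Union>g\<in>D. (+) g ` V)"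
proof -
  obtain F' where F': "F' \<subseteq> (\<lambda>g. (+) g ` V) ` A" "countable F'" "\<Union>F' = (\<Union>g\<in>A. (+) g ` V)"
    by (rule Lindelof[of "(\<lambda>g. (+) g ` V) ` A"]) (use assms(1) open_left_translate in auto)
  then obtain D where D: "countable D" "D \<subseteq> A" "F' = (\<lambda>g. (+) g ` V) ` D"
    by (meson countable_subset_image)
  have "A \<subseteq> (\<Union>g\<in>A. (+) g ` V)"
    using assms(2) by (force intro!: rev_image_eqI[of 0])
  with F' D that[of D] show ?thesis by simp
qed

text \<open>Complete regularity gives a bump at every point of \<open>U\<close>, and by Lindelof
  countably many of their positivity sets cover \<open>U\<close>. This carries an integral formula
  for continuous compactly supported functions to open sets by monotone convergence.\<close>

lemma open_eq_SUP_continuous_compact_support: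
  fixes U :: "'g::{t2_space, second_countable_topology} set"
  assumes lc: "locally_compact_space (euclidean :: 'g topology)" and "open U"
  obtains v :: "nat \<Rightarrow> 'g \<Rightarrow> real"
  where "\<And>n. continuous_on UNIV (v n)" "\<And>n x. 0 \<le> v n x" "incseq v"
    "\<And>n. \<exists>K. compact K \<and> (\<forall>x. x \<notin> K \<longrightarrow> v n x = 0)"
    "\<And>x. (SUP n. ennreal (v n x)) = indicator U x"
proof -
  have haus: "Hausdorff_space (euclidean :: 'g topology)"
    unfolding Hausdorff_space_def disjnt_def using hausdorff by auto
  have creg: "completely_regular_space (euclidean :: 'g topology)"
    using locally_compact_regular_imp_completely_regular_space[OF lc] haus by blast
  have "\<exists>f::'g \<Rightarrow> real. continuous_on UNIV f \<and> f x = 1 \<and> range f \<subseteq> {0..1} \<and>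
      (\<forall>y. y \<notin> U \<longrightarrow> f y = 0) \<and> (\<exists>K. compact K \<and> (\<forall>y. y \<notin> K \<longrightarrow> f y = 0))" if x: "x \<in> U" for x
  proof -
    obtain V K where VK: "open V" "compact K" "x \<in> V" "V \<subseteq> K"
      using lc unfolding locally_compact_space_def by (metis UNIV_I compactin_euclidean_iff open_openin topspace_euclidean)
    \<comment> \<open>Separating from the complement of \<open>U \<inter> V\<close>, not just of
      \<open>U\<close>, also forces the support into the compact \<open>K\<close>. The separating
      function is 0 at \<open>x\<close> and 1 on the closed set, hence \<open>1 - f\<close>
      below.\<close>
    have "closedin euclidean (- (U \<inter> V))" "x \<in> topspace euclidean - (- (U \<inter> V))"
      using x VK \<open>open U\<close> by auto
    then obtain f :: "'g \<Rightarrow> real" where f: "continuous_map euclidean (top_of_set {0..1}) f" "f x = 0"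
        "f ` (- (U \<inter> V)) \<subseteq> {1}"
      using creg unfolding completely_regular_space_def by meson
    have fc: "continuous_on UNIV f" "\<And>y. f y \<in> {0..1}"
      using f(1) by (auto simp: continuous_map_in_subtopology)
    show ?thesis
      using f(2,3) fc VK
      by (intro exI[of _ "\<lambda>y. 1 - f y"]) (auto intro!: continuous_intros exI[of _ K])
  qed
  then have "\<forall>x\<in>U. \<exists>f::'g \<Rightarrow> real. continuous_on UNIV f \<and> f x = 1 \<and> range f \<subseteq> {0..1} \<and>
      (\<forall>y. y \<notin> U \<longrightarrow> f y = 0) \<and> (\<exists>K. compact K \<and> (\<forall>y. y \<notin> K \<longrightarrow> f y = 0))"
    by blast
  from bchoice[OF this] obtain f :: "'g \<Rightarrow> 'g \<Rightarrow> real" where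
    f_ex: "\<forall>x\<in>U. continuous_on UNIV (f x) \<and> f x x = 1 \<and> range (f x) \<subseteq> {0..1} \<and>
      (\<forall>y. y \<notin> U \<longrightarrow> f x y = 0) \<and> (\<exists>K. compact K \<and> (\<forall>y. y \<notin> K \<longrightarrow> f x y = 0))"
    by blast
  then have f: "\<And>x. x \<in> U \<Longrightarrow> continuous_on UNIV (f x)"
    "\<And>x. x \<in> U \<Longrightarrow> f x x = 1" "\<And>x y. x \<in> U \<Longrightarrow> f x y \<in> {0..1}"
    "\<And>x y. x \<in> U \<Longrightarrow> y \<notin> U \<Longrightarrow> f x y = 0"
    "\<And>x. x \<in> U \<Longrightarrow> \<exists>K. compact K \<and> (\<forall>y. y \<notin> K \<longrightarrow> f x y = 0)"
    by blast+
  show thesis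
  proof (cases "U = {}")
    case True
    show thesis
      by (rule that[of "\<lambda>_ _. 0"]) (auto simp: True incseq_def)
  next
    case False
    have "open {y. 0 < f x y}" if "x \<in> U" for x
      using open_Collect_less[OF continuous_on_const f(1)[OF that]] .
    then have "open S" if "S \<in> (\<lambda>x. {y. 0 < f x y}) ` U" for S
      using that by blast
    from Lindelof[OF this] obtain F' where F': "F' \<subseteq> (\<lambda>x. {y. 0 < f x y}) ` U" "countable F'"
        "\<Union>F' = (\<Union>x\<in>U. {y. 0 < f x y})"
      by blast
    then obtain D where D: "countable D" "D \<subseteq> U" "F' = (\<lambda>x. {y. 0 < f x y}) ` D"
      by (meson countable_subset_image)
    have cov: "\<exists>d\<in>D. 0 < f d y" if "y \<in> U" for y
    proof -
      have "y \<in> (\<Union>x\<in>U. {y. 0 < f x y})"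
        using f(2)[OF that] that by (auto intro!: bexI[of _ y])
      then show ?thesis using F'(3) D(3) by auto
    qed
    with False have "D \<noteq> {}" by blast
    then obtain d :: "nat \<Rightarrow> 'g" where d: "range d = D"
      using D(1) by (metis uncountable_def)
    then have dU: "d i \<in> U" for i using D(2) by blast
    \<comment> \<open>The partial sums are eventually positive on \<open>U\<close> but may stay
      below 1; the growing factor lifts them past 1, where the minimum stops them.\<close>
    define v where "v n y = min 1 (real n * (\<Sum>i\<le>n. f (d i) y))" for n y
    note f01 = f(3)[OF dU, simplified]
    have s0: "0 \<le> (\<Sum>i\<le>n. f (d i) y)" for n y
      using f01 by (intro sum_nonneg) auto
    show thesis
    proof (rule that[of v])
      show "continuous_on UNIV (v n)" for n
        unfolding v_def by (intro continuous_intros f dU)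
      show "0 \<le> v n x" for n x
        unfolding v_def using s0 by simp
      show inc: "incseq v"
      proof (rule incseq_SucI)
        fix n
        show "v n \<le> v (Suc n)"
          unfolding v_def le_fun_def
        proof (intro allI min.mono order_refl mult_mono)
          fix y
          show "(\<Sum>i\<le>n. f (d i) y) \<le> (\<Sum>i\<le>Suc n. f (d i) y)" using f01 by simp
        qed (use s0 in auto)
      qed
      show "\<exists>K. compact K \<and> (\<forall>x. x \<notin> K \<longrightarrow> v n x = 0)" for n
      proof -
        obtain K where K: "\<And>i. compact (K i)" "\<And>i y. y \<notin> K i \<Longrightarrow> f (d i) y = 0"
          using f(5)[OF dU] by metis
        show ?thesis
          using K by (intro exI[of _ "\<Union>i\<le>n. K i"]) (auto simp: v_def intro!: compact_UN)
      qed
      fix x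
      show "(SUP n. ennreal (v n x)) = indicator U x"
      proof (cases "x \<in> U")
        case False
        then show ?thesis using f(4)[OF dU] by (simp add: v_def)
      next
        case True
        obtain i where i: "0 < f (d i) x" using cov[OF True] d by auto
        obtain n where n: "1 / f (d i) x < real n" using reals_Archimedean2 by blast
        define k where "k = max i n"
        have "f (d i) x \<le> (\<Sum>i\<le>k. f (d i) x)"
          by (rule member_le_sum) (use f01 in \<open>auto simp: k_def\<close>)
        then have "real n * f (d i) x \<le> real k * (\<Sum>i\<le>k. f (d i) x)"
          using i by (intro mult_mono) (auto simp: k_def)
        moreover have "1 \<le> real n * f (d i) x"
          using n i by (simp add: field_simps)
        ultimately have "v k x = 1" by (simp add: v_def)
        moreover have "v n x \<le> 1" for n by (simp add: v_def)
        ultimately show ?thesis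
          using True by (intro antisym SUP_least) (auto intro!: SUP_upper2[of k])
      qed
    qed
  qed
qed

lemma
  assumes "add_subgroup H"
  shows add_subgroup_zero: "0 \<in> H"
    and add_subgroup_add: "\<And>x y. x \<in> H \<Longrightarrow> y \<in> H \<Longrightarrow> x + y \<in> H"
    and add_subgroup_minus: "\<And>x. x \<in> H \<Longrightarrow> - x \<in> H"
  using assms by (auto simp: add_subgroup_def)

lemma right_coset_eq_iff:
  assumes "add_subgroup H"
  shows "right_coset H a = right_coset H b \<longleftrightarrow> (\<exists>h\<in>H. a = h + b)"
proof
  assume "right_coset H a = right_coset H b"
  moreover have "a \<in> right_coset H a"
    using add_subgroup_zero[OF assms] unfolding right_coset_def by force
  ultimately show "\<exists>h\<in>H. a = h + b" by (auto simp: right_coset_def)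
next
  assume "\<exists>h\<in>H. a = h + b"
  then obtain h where h: "h \<in> H" "a = h + b" by blast
  have "k + b \<in> right_coset H a" if "k \<in> H" for k
  proof -
    have "k + - h \<in> H" "k + b = (k + - h) + a"
      using that h add_subgroup_add[OF assms] add_subgroup_minus[OF assms]
      by (blast, simp add: add.assoc del: add_uminus_conv_diff)
    then show ?thesis unfolding right_coset_def by blast
  qed
  then show "right_coset H a = right_coset H b"
    using h add_subgroup_add[OF assms] by (auto simp: right_coset_def simp flip: add.assoc)
qed

section \<open>Haar measure of a closed unimodular subgroup\<close>

locale haar_subgroup =
  fixes H :: "'g::{topological_group_add, t2_space, second_countable_topology} set"
    and m :: "'g measure"
  assumes locally_compact: "locally_compact_space (euclidean :: 'g topology)"
    and subgroup: "add_subgroup H"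
    and closed: "closed H"
    and unimodular: "unimodular H"
    and haar: "haar_measure H m"
begin

lemmas zero_mem = add_subgroup_zero[OF subgroup]
  and add_mem = add_subgroup_add[OF subgroup]
  and minus_mem = add_subgroup_minus[OF subgroup]

lemma space_eq: "space m = H"
  using haar sets_eq_imp_space_eq[of m "restrict_space borel H"]
  by (simp add: haar_measure_def space_restrict_space)

lemma sets_eq: "sets m = sets (restrict_space borel H)"
  using haar by (simp add: haar_measure_def)

lemma inter_sets: "A \<in> sets borel \<Longrightarrow> A \<inter> H \<in> sets m"
  by (auto simp: sets_eq sets_restrict_space Int_commute)

text \<open>Lets Borel functions on all of G be integrated against \<open>m\<close>, whose sets lie
  inside H.\<close>

lemma measurable_id [measurable]: "(\<lambda>h. h) \<in> m \<rightarrow>\<^sub>M borel"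
  unfolding measurable_cong_sets[OF sets_eq refl] by (rule measurable_restrict_space1) simp

lemma measurable_translate:
  assumes "h \<in> H"
  shows "(\<lambda>x. h + x) \<in> m \<rightarrow>\<^sub>M m" "(\<lambda>x. x + h) \<in> m \<rightarrow>\<^sub>M m"
proof -
  have "(\<lambda>x. h + x) \<in> m \<rightarrow>\<^sub>M restrict_space borel H" "(\<lambda>x. x + h) \<in> m \<rightarrow>\<^sub>M restrict_space borel H"
    using assms add_mem by (auto intro!: measurable_restrict_space2 simp: space_eq)
  then show "(\<lambda>x. h + x) \<in> m \<rightarrow>\<^sub>M m" "(\<lambda>x. x + h) \<in> m \<rightarrow>\<^sub>M m"
    unfolding measurable_cong_sets[OF refl sets_eq] .
qed

lemma emeasure_space_pos: "0 < emeasure m H"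
  using haar by (simp add: haar_measure_def zero_less_iff_neq_zero)

lemma distr_left: "h \<in> H \<Longrightarrow> distr m m (\<lambda>x. h + x) = m"
  using haar by (simp add: haar_measure_def)

lemma distr_right: "h \<in> H \<Longrightarrow> distr m m (\<lambda>x. x + h) = m"
  using haar unimodular by (simp add: unimodular_def)

lemma nn_integral_left:
  assumes "h \<in> H" and [measurable]: "u \<in> borel_measurable borel"
  shows "(\<integral>\<^sup>+x. u (h + x) \<partial>m) = (\<integral>\<^sup>+x. u x \<partial>m)"
proof -
  have "(\<integral>\<^sup>+x. u x \<partial>m) = (\<integral>\<^sup>+x. u x \<partial>distr m m (\<lambda>x. h + x))"
    using distr_left assms by simp
  also have "\<dots> = (\<integral>\<^sup>+x. u (h + x) \<partial>m)"
    by (rule nn_integral_distr[OF measurable_translate(1)[OF assms(1)]]) measurable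
  finally show ?thesis by simp
qed

lemma nn_integral_right:
  assumes "h \<in> H" and [measurable]: "u \<in> borel_measurable borel"
  shows "(\<integral>\<^sup>+x. u (x + h) \<partial>m) = (\<integral>\<^sup>+x. u x \<partial>m)"
proof -
  have "(\<integral>\<^sup>+x. u x \<partial>m) = (\<integral>\<^sup>+x. u x \<partial>distr m m (\<lambda>x. x + h))"
    using distr_right assms by simp
  also have "\<dots> = (\<integral>\<^sup>+x. u (x + h) \<partial>m)"
    by (rule nn_integral_distr[OF measurable_translate(2)[OF assms(1)]]) measurable
  finally show ?thesis by simp
qed

lemma nn_integral_coset:
  assumes "h \<in> H" and [measurable]: "u \<in> borel_measurable borel"
  shows "(\<integral>\<^sup>+x. u (x + (h + g)) \<partial>m) = (\<integral>\<^sup>+x. u (x + g) \<partial>m)"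
  using nn_integral_right[OF assms(1), of "\<lambda>x. u (x + g)"] by (simp add: add.assoc)

lemma nn_integral_indicator_right:
  assumes [measurable]: "A \<in> sets borel"
  shows "(\<integral>\<^sup>+x. indicator A (x + g) \<partial>m) = emeasure m ({x. x + g \<in> A} \<inter> H)"
proof -
  have [measurable]: "{x. x + g \<in> A} \<in> sets borel"
    by measurable
  have "(\<integral>\<^sup>+x. indicator A (x + g) \<partial>m) = (\<integral>\<^sup>+x. indicator ({x. x + g \<in> A} \<inter> H) x \<partial>m)"
    by (intro nn_integral_cong) (auto simp: indicator_def space_eq)
  then show ?thesis by (simp add: inter_sets)
qed

lemma emeasure_compact:
  assumes "compact K"
  shows "emeasure m (K \<inter> H) < \<infinity>"
  using haar assms closed by (auto simp: haar_measure_def intro!: compact_Int_closed)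

text \<open>Were it null, so would be the countably many translates by elements of H that cover H,
  against the nontriviality of Haar measure.\<close>

lemma emeasure_nhd_pos:
  assumes "W \<in> sets borel" "0 \<in> interior W"
  shows "0 < emeasure m (W \<inter> H)"
proof (rule ccontr)
  assume "\<not> 0 < emeasure m (W \<inter> H)"
  then have W0: "emeasure m (W \<inter> H) = 0" by (simp add: zero_less_iff_neq_zero)
  obtain D where D: "countable D" "D \<subseteq> H" "H \<subseteq> (\<Union>g\<in>D. (+) g ` interior W)"
    using countable_translate_cover[OF open_interior assms(2)] by blast
  have "(+) g ` interior W \<inter> H \<in> null_sets m" if "g \<in> D" for g
  proof -
    have gH: "- g \<in> H" using D that minus_mem by blast
    have "emeasure m ((+) g ` interior W \<inter> H) = (\<integral>\<^sup>+x. indicator (interior W) (- g + x) \<partial>m)"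
      by (subst nn_integral_indicator[symmetric], simp add: inter_sets open_left_translate,
          intro nn_integral_cong)
         (auto simp: indicator_def space_eq mem_left_translate_iff)
    also have "\<dots> = (\<integral>\<^sup>+x. indicator (interior W) x \<partial>m)"
      using gH by (intro nn_integral_left[of _ "indicator (interior W)"]) auto
    also have "\<dots> = emeasure m (interior W \<inter> H)"
      using nn_integral_indicator_right[of "interior W" 0] by simp
    also have "\<dots> \<le> emeasure m (W \<inter> H)"
      using assms(1) interior_subset by (intro emeasure_mono inter_sets) auto
    finally show ?thesis using W0 by (auto simp: null_sets_def inter_sets open_left_translate)
  qed
  then have "(\<Union>g\<in>D. (+) g ` interior W \<inter> H) \<in> null_sets m"
    using D(1) by (intro null_sets_UN') auto
  moreover have "(\<Union>g\<in>D. (+) g ` interior W \<inter> H) = H" using D by blast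
  ultimately show False using haar by (auto simp: haar_measure_def null_sets_def)
qed

text \<open>Here the translates of \<open>W\<close> may be by any element of G: each is compact, so
  its trace on H has finite mass, and no invariance is involved.\<close>

lemma sigma_finite: "sigma_finite_measure m"
proof
  obtain W :: "'g set" where W: "compact W" "0 \<in> interior W"
    by (rule locally_compact_group_nhd[OF locally_compact])
  obtain D where D: "countable D" "UNIV \<subseteq> (\<Union>g\<in>D. (+) g ` interior W)"
    using countable_translate_cover[OF open_interior W(2), of UNIV] by auto
  let ?A = "(\<lambda>g. (+) g ` W \<inter> H) ` D"
  show "\<exists>A. countable A \<and> A \<subseteq> sets m \<and> \<Union>A = space m \<and> (\<forall>a\<in>A. emeasure m a \<noteq> \<infinity>)"
  proof (intro exI[of _ ?A] conjI)
    show "countable ?A" using D by blast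
    show "?A \<subseteq> sets m"
      using W compact_left_translate by (auto intro!: inter_sets borel_closed compact_imp_closed)
    have "UNIV = (\<Union>g\<in>D. (+) g ` W)"
      using D(2) interior_subset[of W] by blast
    then show "\<Union>?A = space m" unfolding space_eq by blast
    show "\<forall>a\<in>?A. emeasure m a \<noteq> \<infinity>"
    proof
      fix a assume "a \<in> ?A"
      then obtain g where "a = (+) g ` W \<inter> H" by blast
      then show "emeasure m a \<noteq> \<infinity>"
        using emeasure_compact[OF compact_left_translate[OF W(1), of g]] by simp
    qed
  qed
qed

text \<open>Integrability is not at issue: when the integral is infinite, the Bochner integral and
  \<open>enn2real\<close> both default to 0.\<close>

lemma integral_coset_eq:
  assumes [measurable]: "u \<in> borel_measurable borel" and "\<And>x. 0 \<le> u x"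
  shows "(\<integral>x. complex_of_real (u (x + g)) \<partial>m) = of_real (enn2real (\<integral>\<^sup>+x. ennreal (u (x + g)) \<partial>m))"
  using assms(2) by (simp add: integral_eq_nn_integral)

text \<open>
  If some \<open>h\<^sub>0 + g\<close> with \<open>h\<^sub>0\<close> in \<open>H\<close> lies in \<open>K\<close>, then \<open>h + (h\<^sub>0 + g) \<in> K\<close> forces \<open>h \<in> K - K\<close>;
  hence the bound is uniform in \<open>g\<close>.
\<close>

lemma nn_integral_coset_bound:
  assumes "compact K" and [measurable]: "u \<in> borel_measurable borel"
    and "\<And>x. u x \<le> B * indicator K x"
  shows "(\<integral>\<^sup>+x. u (x + g) \<partial>m) \<le> B * emeasure m ((\<lambda>(x, y). x + y) ` (K \<times> uminus ` K) \<inter> H)"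
    (is "_ \<le> B * emeasure m (?D \<inter> H)")
proof (cases "\<exists>h\<in>H. h + g \<in> K")
  case False
  have "u (x + g) = 0" if "x \<in> space m" for x
  proof -
    have "x + g \<notin> K" using False that by (auto simp: space_eq)
    then show ?thesis using assms(3)[of "x + g"] by simp
  qed
  then have "(\<integral>\<^sup>+x. u (x + g) \<partial>m) = (\<integral>\<^sup>+x. 0 \<partial>m)"
    by (intro nn_integral_cong)
  then show ?thesis by simp
next
  case True
  then obtain h where h: "h \<in> H" "h + g \<in> K" by blast
  have D: "?D \<in> sets borel"
    using assms(1) by (intro borel_closed compact_imp_closed compact_set_plus compact_uminus_image)
  have "(\<integral>\<^sup>+x. u (x + g) \<partial>m) = (\<integral>\<^sup>+x. u (x + (h + g)) \<partial>m)"
    using nn_integral_coset[OF h(1)] by simp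
  also have "\<dots> \<le> (\<integral>\<^sup>+x. B * indicator (?D \<inter> H) x \<partial>m)"
  proof (intro nn_integral_mono order_trans[OF assms(3)] mult_left_mono)
    fix x assume "x \<in> space m"
    then have "x \<in> ?D \<inter> H" if "x + (h + g) \<in> K"
      using that h(2) by (auto simp: space_eq intro!: image_eqI[of _ _ "(x + (h + g), - (h + g))"])
    then show "indicator K (x + (h + g)) \<le> (indicator (?D \<inter> H) x :: ennreal)"
      by (auto simp: indicator_def)
  qed simp
  also have "\<dots> = B * emeasure m (?D \<inter> H)"
    using inter_sets[OF D] by (subst nn_integral_cmult_indicator) auto
  finally show ?thesis .
qed

lemma nn_integral_coset_finite:
  assumes "compact K" and "u \<in> borel_measurable borel"
    and "\<And>x. u x \<le> B * indicator K x" and "B < \<infinity>"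
  shows "(\<integral>\<^sup>+x. u (x + g) \<partial>m) < \<infinity>"
proof -
  have "emeasure m ((\<lambda>(x, y). x + y) ` (K \<times> uminus ` K) \<inter> H) < \<infinity>"
    using assms(1) by (intro emeasure_compact compact_set_plus compact_uminus_image)
  with nn_integral_coset_bound[OF assms(1-3)] assms(4) show ?thesis
    by (metis ennreal_mult_less_top infinity_ennreal_def order_le_less_trans)
qed

text \<open>
  Evaluate \<open>\<integral>\<integral> 1\<^sub>W(x) u(- x + y)\<close> in both orders of integration.
\<close>

lemma nn_integral_uminus:
  assumes [measurable]: "u \<in> borel_measurable borel"
  shows "(\<integral>\<^sup>+x. u (- x) \<partial>m) = (\<integral>\<^sup>+x. u x \<partial>m)"
proof -
  interpret sigma_finite_measure m by (rule sigma_finite)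
  interpret pair_sigma_finite m m ..
  obtain W :: "'g set" where W: "compact W" "0 \<in> interior W"
    by (rule locally_compact_group_nhd[OF locally_compact])
  have WB [measurable]: "W \<in> sets borel"
    using W by (intro borel_closed compact_imp_closed)
  let ?c = "\<integral>\<^sup>+x. indicator W x \<partial>m"
  have c: "?c = emeasure m (W \<inter> H)"
    using nn_integral_indicator_right[OF WB, of 0] by simp
  have "?c * (\<integral>\<^sup>+y. u y \<partial>m) = (\<integral>\<^sup>+x. indicator W x * (\<integral>\<^sup>+y. u y \<partial>m) \<partial>m)"
    by (subst nn_integral_multc) auto
  also have "\<dots> = (\<integral>\<^sup>+x. \<integral>\<^sup>+y. indicator W x * u (- x + y) \<partial>m \<partial>m)"
    by (intro nn_integral_cong)
       (simp add: nn_integral_cmult nn_integral_left minus_mem space_eq)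
  also have "\<dots> = (\<integral>\<^sup>+y. \<integral>\<^sup>+x. indicator W x * u (- x + y) \<partial>m \<partial>m)"
    by (rule Fubini'[symmetric]) measurable
  \<comment> \<open>For fixed y, left invariance replaces x by y + x, and -(y + x) + y = -x.\<close>
  also have "\<dots> = (\<integral>\<^sup>+y. \<integral>\<^sup>+x. indicator W (y + x) * u (- x) \<partial>m \<partial>m)"
  proof (rule nn_integral_cong)
    fix y assume "y \<in> space m"
    then have "(\<integral>\<^sup>+x. indicator W x * u (- x + y) \<partial>m) = (\<integral>\<^sup>+x. indicator W (y + x) * u (- (y + x) + y) \<partial>m)"
      by (subst nn_integral_left[symmetric, of y]) (simp_all add: space_eq)
    then show "(\<integral>\<^sup>+x. indicator W x * u (- x + y) \<partial>m) = (\<integral>\<^sup>+x. indicator W (y + x) * u (- x) \<partial>m)"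
      by (simp add: minus_add add.assoc)
  qed
  also have "\<dots> = (\<integral>\<^sup>+x. \<integral>\<^sup>+y. indicator W (y + x) * u (- x) \<partial>m \<partial>m)"
    by (rule Fubini') measurable
  \<comment> \<open>Unimodularity enters here: the integral over y of the indicator of
    \<open>W\<close> at y + x does not depend on x.\<close>
  also have "\<dots> = (\<integral>\<^sup>+x. ?c * u (- x) \<partial>m)"
    by (intro nn_integral_cong) (simp add: nn_integral_multc nn_integral_right[of _ "indicator W"] space_eq)
  also have "\<dots> = ?c * (\<integral>\<^sup>+x. u (- x) \<partial>m)"
    by (rule nn_integral_cmult) measurable
  finally have "?c * (\<integral>\<^sup>+x. u x \<partial>m) = ?c * (\<integral>\<^sup>+x. u (- x) \<partial>m)" .
  \<comment> \<open>\<open>W\<close> is a compact neighbourhood of the identity precisely so that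
    its mass can be cancelled in \<open>ennreal\<close>.\<close>
  moreover have "0 < ?c" "?c < \<infinity>"
    using emeasure_nhd_pos[OF WB W(2)] emeasure_compact[OF W(1)] by (simp_all add: c)
  ultimately show ?thesis
    by (auto simp: ennreal_mult_cancel_left)
qed

end

section \<open>The quotient integral formula\<close>

text \<open>The whole group is the instance \<open>H = UNIV\<close>, so each fact on Haar measures
  is available for G with the prefix \<open>G\<close> and for H without one.\<close>

locale homogeneous_space =
  G: haar_subgroup UNIV mG + haar_subgroup H mH
  for H :: "'g::{topological_group_add, t2_space, second_countable_topology} set" and mG mH +
  fixes mHG :: "'g set measure"
  assumes quotient: "quotient_haar_measure H mG mH mHG"
begin

lemma sets_mG: "sets mG = sets borel"
  using G.sets_eq by simp

section \<open>Open, compact and measurable sets of cosets\<close>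

lemma right_coset_add: "h \<in> H \<Longrightarrow> right_coset H (h + g) = right_coset H g"
  using right_coset_eq_iff[OF subgroup] by blast

lemma space_quotient: "space mHG = range (right_coset H)"
  using quotient by (simp add: quotient_haar_measure_def right_cosets_def)

lemma sets_quotient: "sets mHG = sigma_sets (right_cosets H) {U. openin (coset_topology H) U}"
  using quotient by (simp add: quotient_haar_measure_def borel_sets_of_def topspace_coset_topology)

lemma openin_sets: "openin (coset_topology H) U \<Longrightarrow> U \<in> sets mHG"
  by (simp add: sets_quotient sigma_sets.Basic)

lemma right_coset_measurable [measurable]: "right_coset H \<in> borel \<rightarrow>\<^sub>M mHG"
  by (rule measurable_sigma_sets[OF sets_quotient])
     (auto simp: right_cosets_def openin_coset_topology)

lemma right_coset_measurable_mG [measurable]: "right_coset H \<in> mG \<rightarrow>\<^sub>M mHG"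
  using right_coset_measurable measurable_cong_sets[OF sets_mG refl] by blast

lemma right_coset_vimage_image:
  "right_coset H -` right_coset H ` A = (\<lambda>(x, y). x + y) ` (H \<times> A)"
proof -
  have "right_coset H (h + g) \<in> right_coset H ` A" if "h \<in> H" "g \<in> A" for h g
    using that by (simp add: right_coset_add)
  then show ?thesis
    by (fastforce simp: right_coset_eq_iff[OF subgroup])
qed

lemma openin_image:
  assumes "open V"
  shows "openin (coset_topology H) (right_coset H ` V)"
proof -
  have "(\<lambda>(x, y). x + y) ` (H \<times> V) = (\<Union>h\<in>H. (+) h ` V)" by auto
  then show ?thesis
    using assms by (auto simp: openin_coset_topology right_cosets_def right_coset_vimage_image
        intro!: open_left_translate)
qed

lemma continuous_map_right_coset: "continuous_map euclidean (coset_topology H) (right_coset H)"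
  by (auto simp: continuous_map_def topspace_coset_topology openin_coset_topology right_cosets_def
      vimage_def)

lemma compactin_image: "compact C \<Longrightarrow> compactin (coset_topology H) (right_coset H ` C)"
  using image_compactin[OF _ continuous_map_right_coset] by simp

lemma compact_image_sets:
  assumes "compact C"
  shows "right_coset H ` C \<in> sets mHG"
proof -
  let ?D = "right_cosets H - right_coset H ` C"
  have "right_coset H -` ?D = - (\<lambda>(x, y). x + y) ` (H \<times> C)"
    unfolding right_coset_vimage_image[symmetric] by (auto simp: right_cosets_def)
  then have "openin (coset_topology H) ?D"
    using closed_plus_compact[OF closed assms] by (simp add: openin_coset_topology open_Compl)
  then have "space mHG - ?D \<in> sets mHG"
    by (intro sets.compl_sets openin_sets)
  moreover have "space mHG - ?D = right_coset H ` C"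
    by (auto simp: space_quotient right_cosets_def)
  ultimately show ?thesis by simp
qed

lemma emeasure_compact_image:
  assumes "compact C"
  shows "emeasure mHG (right_coset H ` C) < \<infinity>"
  using quotient compactin_image[OF assms] by (auto simp: quotient_haar_measure_def)

text \<open>The projection is open, so finitely many images of translates of
  \<open>interior W\<close> cover \<open>K\<close>; the same translates of \<open>W\<close> form the
  compact set. Supports in the coset space can thus be handled in G.\<close>

lemma compactin_covered:
  assumes "compactin (coset_topology H) K"
  obtains C where "compact C" "K \<subseteq> right_coset H ` C"
proof -
  obtain W :: "'g set" where W: "compact W" "0 \<in> interior W"
    by (rule locally_compact_group_nhd[OF locally_compact])
  let ?U = "(\<lambda>g. right_coset H ` (+) g ` interior W) ` UNIV"
  have "K \<subseteq> \<Union>?U"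
  proof
    fix c assume "c \<in> K"
    then have "c \<in> right_cosets H"
      using compactin_subset_topspace[OF assms] by (auto simp: topspace_coset_topology)
    then obtain g where "c = right_coset H g" by (auto simp: right_cosets_def)
    moreover have "g \<in> (+) g ` interior W"
      using W(2) by (simp add: mem_left_translate_iff)
    ultimately show "c \<in> \<Union>?U" by blast
  qed
  moreover have "\<And>U. U \<in> ?U \<Longrightarrow> openin (coset_topology H) U"
    by (auto intro!: openin_image open_left_translate)
  ultimately obtain F where F: "finite F" "F \<subseteq> ?U" "K \<subseteq> \<Union>F"
    using compactinD[OF assms] by meson
  then obtain D where D: "finite D" "F = (\<lambda>g. right_coset H ` (+) g ` interior W) ` D"
    by (meson finite_subset_image)
  show thesis
  proof
    show "compact (\<Union>g\<in>D. (+) g ` W)"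
      using D(1) W(1) by (intro compact_UN) (auto intro: compact_left_translate)
    show "K \<subseteq> right_coset H ` (\<Union>g\<in>D. (+) g ` W)"
      using F(3) interior_subset[of W] unfolding D(2) by blast
  qed
qed

section \<open>Extension of the quotient integral formula to nonnegative Borel functions\<close>

text \<open>
  Integration along cosets. Choosing a representative makes \<open>fibre_integral\<close> additive and continuous
  from below in \<open>u\<close> without any invariance argument.
\<close>

definition rep :: "'g set \<Rightarrow> 'g" where
  "rep c = (SOME g. right_coset H g = c)"

definition fibre_integral :: "('g \<Rightarrow> ennreal) \<Rightarrow> 'g set \<Rightarrow> ennreal" where
  "fibre_integral u c = (\<integral>\<^sup>+h. u (h + rep c) \<partial>mH)"

lemma fibre_integral_right_coset:
  assumes "u \<in> borel_measurable borel"
  shows "fibre_integral u (right_coset H g) = (\<integral>\<^sup>+h. u (h + g) \<partial>mH)"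
proof -
  have "right_coset H (rep (right_coset H g)) = right_coset H g"
    unfolding rep_def by (rule someI) (rule refl)
  then obtain h where "h \<in> H" "rep (right_coset H g) = h + g"
    using right_coset_eq_iff[OF subgroup] by blast
  then show ?thesis
    using nn_integral_coset assms by (simp add: fibre_integral_def)
qed

text \<open>Measurability of the fibre integral is bundled in because it has no independent proof
  for Borel \<open>u\<close>: it is carried along with the identity through sums, differences and
  monotone limits.\<close>

definition disintegrates :: "('g \<Rightarrow> ennreal) \<Rightarrow> bool" where
  "disintegrates u \<longleftrightarrow> u \<in> borel_measurable borel \<and> fibre_integral u \<in> borel_measurable mHG \<and>
     (\<integral>\<^sup>+g. u g \<partial>mG) = (\<integral>\<^sup>+c. fibre_integral u c \<partial>mHG)"

lemma borel_measurable_mG [measurable_dest]: "u \<in> borel_measurable borel \<Longrightarrow> u \<in> borel_measurable mG"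
  using measurable_cong_sets[OF sets_mG refl] by blast

lemma disintegrates_add:
  assumes "disintegrates u" "disintegrates v"
  shows "disintegrates (\<lambda>x. u x + v x)"
proof -
  have [measurable]: "u \<in> borel_measurable borel" "v \<in> borel_measurable borel"
    "fibre_integral u \<in> borel_measurable mHG" "fibre_integral v \<in> borel_measurable mHG"
    using assms by (auto simp: disintegrates_def)
  have "fibre_integral (\<lambda>x. u x + v x) = (\<lambda>c. fibre_integral u c + fibre_integral v c)"
    unfolding fibre_integral_def by (intro ext nn_integral_add) measurable
  then show ?thesis
    using assms by (simp add: disintegrates_def nn_integral_add borel_measurable_mG)
qed

lemma disintegrates_cmult:
  assumes "disintegrates u"
  shows "disintegrates (\<lambda>x. b * u x)"
proof -
  have [measurable]: "u \<in> borel_measurable borel" "fibre_integral u \<in> borel_measurable mHG"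
    using assms by (auto simp: disintegrates_def)
  have "fibre_integral (\<lambda>x. b * u x) = (\<lambda>c. b * fibre_integral u c)"
    unfolding fibre_integral_def by (intro ext nn_integral_cmult) measurable
  then show ?thesis
    using assms by (simp add: disintegrates_def nn_integral_cmult borel_measurable_mG)
qed

lemma disintegrates_SUP:
  assumes "\<And>i::nat. disintegrates (U i)" "incseq U"
  shows "disintegrates (\<lambda>x. SUP i. U i x)"
proof -
  have [measurable]: "U i \<in> borel_measurable borel" "fibre_integral (U i) \<in> borel_measurable mHG" for i
    using assms(1) by (auto simp: disintegrates_def)
  have *: "fibre_integral (\<lambda>x. SUP i. U i x) = (\<lambda>c. SUP i. fibre_integral (U i) c)"
    unfolding fibre_integral_def
    using assms(2) by (intro ext nn_integral_monotone_convergence_SUP) (auto simp: incseq_def le_fun_def)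
  have "incseq (\<lambda>i. fibre_integral (U i))"
    using assms(2) by (auto simp: incseq_def le_fun_def fibre_integral_def intro!: nn_integral_mono)
  then have "(\<integral>\<^sup>+c. (SUP i. fibre_integral (U i) c) \<partial>mHG) = (SUP i. \<integral>\<^sup>+c. fibre_integral (U i) c \<partial>mHG)"
    by (intro nn_integral_monotone_convergence_SUP) auto
  also have "\<dots> = (SUP i. \<integral>\<^sup>+g. U i g \<partial>mG)"
    using assms(1) by (simp add: disintegrates_def)
  also have "\<dots> = (\<integral>\<^sup>+g. (SUP i. U i g) \<partial>mG)"
    using assms(2) by (intro nn_integral_monotone_convergence_SUP[symmetric]) (auto intro: borel_measurable_mG)
  finally show ?thesis
    by (simp add: disintegrates_def *)
qed

text \<open>The two finiteness assumptions make subtraction in \<open>ennreal\<close> commute with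
  the integrals; they are the reason for localizing to relatively compact sets later on.\<close>

lemma disintegrates_diff:
  assumes "disintegrates u" "disintegrates v" and le: "\<And>x. u x \<le> v x"
    and "\<And>c. fibre_integral u c < \<infinity>" and "(\<integral>\<^sup>+x. u x \<partial>mG) < \<infinity>"
  shows "disintegrates (\<lambda>x. v x - u x)"
proof -
  have [measurable]: "u \<in> borel_measurable borel" "v \<in> borel_measurable borel"
    "fibre_integral u \<in> borel_measurable mHG" "fibre_integral v \<in> borel_measurable mHG"
    using assms by (auto simp: disintegrates_def)
  have *: "fibre_integral (\<lambda>x. v x - u x) = (\<lambda>c. fibre_integral v c - fibre_integral u c)"
    using assms(4) unfolding fibre_integral_def
    by (intro ext nn_integral_diff) (auto simp: le less_top)
  have "fibre_integral u c \<le> fibre_integral v c" for c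
    unfolding fibre_integral_def by (intro nn_integral_mono le)
  then have "(\<integral>\<^sup>+c. fibre_integral v c - fibre_integral u c \<partial>mHG) =
      (\<integral>\<^sup>+c. fibre_integral v c \<partial>mHG) - (\<integral>\<^sup>+c. fibre_integral u c \<partial>mHG)"
    using assms(1,5)
    by (intro nn_integral_diff) (auto simp: disintegrates_def)
  moreover have "(\<integral>\<^sup>+g. v g - u g \<partial>mG) = (\<integral>\<^sup>+g. v g \<partial>mG) - (\<integral>\<^sup>+g. u g \<partial>mG)"
    using assms(5) by (intro nn_integral_diff borel_measurable_mG) (auto simp: le)
  ultimately show ?thesis
    using assms(1,2) by (simp add: disintegrates_def *)
qed

text \<open>
  The fibre integral of a continuous function is lower semicontinuous by Fatou's lemma, which settles
  measurability; equality is the defining property of \<open>mHG\<close>.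
\<close>

lemma disintegrates_continuous:
  fixes v :: "'g \<Rightarrow> real"
  assumes cont: "continuous_on UNIV v" and nonneg: "\<And>x. 0 \<le> v x"
    and K: "compact K" "\<And>x. x \<notin> K \<Longrightarrow> v x = 0"
  shows "disintegrates v"
proof -
  have [measurable]: "v \<in> borel_measurable borel"
    using cont by (rule borel_measurable_continuous_onI)
  let ?v = "\<lambda>x. ennreal (v x)"
  have q: "fibre_integral ?v (right_coset H g) = (\<integral>\<^sup>+h. v (h + g) \<partial>mH)" for g
    by (rule fibre_integral_right_coset) measurable
  have meas: "fibre_integral ?v \<in> borel_measurable mHG"
  proof (rule borel_measurableI_greater)
    fix a
    let ?S = "{c \<in> space mHG. a < fibre_integral ?v c}"
    \<comment> \<open>The complement of this set is the preimage of the superlevel set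
      \<open>?S\<close>, so its closedness in G says that \<open>?S\<close> is open in the
      quotient.\<close>
    have "closed {g. (\<integral>\<^sup>+h. v (h + g) \<partial>mH) \<le> a}"
      unfolding closed_sequential_limits
    proof (intro allI impI; elim conjE)
      fix s l assume s: "\<forall>n. s n \<in> {g. (\<integral>\<^sup>+h. v (h + g) \<partial>mH) \<le> a}" and l: "s \<longlonglongrightarrow> l"
      have lim: "liminf (\<lambda>n. ?v (h + s n)) = ?v (h + l)" for h
      proof (rule lim_imp_Liminf)
        have "(\<lambda>n. v (h + s n)) \<longlonglongrightarrow> v (h + l)"
          by (rule continuous_on_tendsto_compose[OF cont]) (auto intro!: tendsto_intros l)
        then show "(\<lambda>n. ?v (h + s n)) \<longlonglongrightarrow> ?v (h + l)" by (rule tendsto_ennrealI)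
      qed simp
      have "(\<integral>\<^sup>+h. v (h + l) \<partial>mH) = (\<integral>\<^sup>+h. liminf (\<lambda>n. ?v (h + s n)) \<partial>mH)"
        by (simp add: lim)
      also have "\<dots> \<le> liminf (\<lambda>n. \<integral>\<^sup>+h. v (h + s n) \<partial>mH)"
        by (rule nn_integral_liminf) measurable
      also have "\<dots> \<le> a"
        using s by (intro Liminf_le) (auto intro: always_eventually)
      finally show "l \<in> {g. (\<integral>\<^sup>+h. v (h + g) \<partial>mH) \<le> a}" by simp
    qed
    moreover have "right_coset H -` ?S = - {g. (\<integral>\<^sup>+h. v (h + g) \<partial>mH) \<le> a}"
      by (auto simp: q space_quotient not_le)
    ultimately have "openin (coset_topology H) ?S"
      by (auto simp: openin_coset_topology right_cosets_def space_quotient open_Compl)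
    then show "?S \<in> sets mHG" by (rule openin_sets)
  qed
  obtain b where b: "\<And>x. v x \<le> b"
  proof -
    have "bounded (v ` K)"
      using compact_continuous_image[OF continuous_on_subset[OF cont] K(1)]
      by (auto intro: compact_imp_bounded)
    then obtain b where b: "\<And>x. x \<in> K \<Longrightarrow> \<bar>v x\<bar> \<le> b"
      by (auto simp: bounded_iff)
    have "v x \<le> max b 0" for x
      using b[of x] K(2)[of x] by (cases "x \<in> K") auto
    then show ?thesis by (rule that)
  qed
  have vb: "?v x \<le> ennreal b * indicator K x" for x
    using b[of x] K(2)[of x] by (cases "x \<in> K") (auto intro: ennreal_leI)
  \<comment> \<open>The given formula compares Bochner integrals and so only yields equality after
    \<open>enn2real\<close>, which sends infinity to 0. Both sides must be known finite before
    equality in \<open>ennreal\<close> follows.\<close>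
  have finG: "(\<integral>\<^sup>+g. v g \<partial>mG) < \<infinity>"
    using G.nn_integral_coset_finite[OF K(1) _ vb, of 0] by simp
  define B where "B = ennreal b * emeasure mH ((\<lambda>(x, y). x + y) ` (K \<times> uminus ` K) \<inter> H)"
  have "B < \<infinity>"
    using emeasure_compact[OF compact_set_plus[OF K(1) compact_uminus_image[OF K(1)]]]
    by (simp add: B_def ennreal_mult_less_top)
  have qB: "fibre_integral ?v c \<le> B" for c
    unfolding fibre_integral_def B_def
    by (rule nn_integral_coset_bound[OF K(1) _ vb]) measurable
  have q0: "fibre_integral ?v c = 0" if c: "c \<in> space mHG" "c \<notin> right_coset H ` K" for c
  proof -
    obtain g where g: "c = right_coset H g" using c(1) by (auto simp: space_quotient)
    have "v (h + g) = 0" if "h \<in> H" for h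
      using right_coset_add[OF that, of g] c(2) K(2) g by (metis image_eqI)
    then have "(\<integral>\<^sup>+h. v (h + g) \<partial>mH) = (\<integral>\<^sup>+h. 0 \<partial>mH)"
      by (intro nn_integral_cong) (simp add: space_eq)
    then show ?thesis by (simp add: g q)
  qed
  have "(\<integral>\<^sup>+c. fibre_integral ?v c \<partial>mHG) \<le> (\<integral>\<^sup>+c. B * indicator (right_coset H ` K) c \<partial>mHG)"
    using qB q0 by (intro nn_integral_mono) (auto simp: indicator_def)
  also have "\<dots> = B * emeasure mHG (right_coset H ` K)"
    using compact_image_sets[OF K(1)] by (simp add: nn_integral_cmult_indicator)
  also have "\<dots> < \<infinity>"
    using \<open>B < \<infinity>\<close> emeasure_compact_image[OF K(1)] by (simp add: ennreal_mult_less_top)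
  finally have finHG: "(\<integral>\<^sup>+c. fibre_integral ?v c \<partial>mHG) < \<infinity>" .

  let ?f = "\<lambda>x. complex_of_real (v x)"
  have "?f \<in> Cc euclidean"
    using cont K unfolding Cc_def by (auto intro!: exI[of _ K] continuous_intros)
  then have "(\<integral>g. ?f g \<partial>mG) = (\<integral>c. on_coset (\<lambda>g. \<integral>h. ?f (h + g) \<partial>mH) c \<partial>mHG)"
    using quotient unfolding quotient_haar_measure_def by blast
  also have "\<dots> = (\<integral>c. complex_of_real (enn2real (fibre_integral ?v c)) \<partial>mHG)"
  proof (intro Bochner_Integration.integral_cong refl)
    fix c assume "c \<in> space mHG"
    then obtain g where g: "c = right_coset H g" by (auto simp: space_quotient)
    have I: "(\<integral>h. ?f (h + g) \<partial>mH) = of_real (enn2real (fibre_integral ?v (right_coset H g)))" for g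
      unfolding q by (rule integral_coset_eq) (simp_all add: nonneg)
    show "on_coset (\<lambda>g. \<integral>h. ?f (h + g) \<partial>mH) c = complex_of_real (enn2real (fibre_integral ?v c))"
      unfolding g I by (rule on_coset_right_coset[OF subgroup]) (simp add: right_coset_add)
  qed
  also have "\<dots> = of_real (enn2real (\<integral>\<^sup>+c. ennreal (enn2real (fibre_integral ?v c)) \<partial>mHG))"
    using meas by (simp add: integral_eq_nn_integral)
  \<comment> \<open>Fibre integrals are bounded by the finite \<open>B\<close>, so nothing is lost
    in passing through the reals.\<close>
  also have "(\<integral>\<^sup>+c. ennreal (enn2real (fibre_integral ?v c)) \<partial>mHG) = (\<integral>\<^sup>+c. fibre_integral ?v c \<partial>mHG)"
    using qB \<open>B < \<infinity>\<close> by (intro nn_integral_cong ennreal_enn2real) (metis infinity_ennreal_def order_le_less_trans)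
  finally have "enn2real (\<integral>\<^sup>+g. v g \<partial>mG) = enn2real (\<integral>\<^sup>+c. fibre_integral ?v c \<partial>mHG)"
    using G.integral_coset_eq[of v 0] nonneg by simp
  then have "(\<integral>\<^sup>+g. v g \<partial>mG) = (\<integral>\<^sup>+c. fibre_integral ?v c \<partial>mHG)"
    using finG finHG by (metis ennreal_enn2real infinity_ennreal_def)
  with meas show ?thesis by (simp add: disintegrates_def)
qed

lemma disintegrates_open:
  assumes "open U"
  shows "disintegrates (indicator U)"
proof -
  obtain v :: "nat \<Rightarrow> 'g \<Rightarrow> real" where v: "\<And>n. continuous_on UNIV (v n)" "\<And>n x. 0 \<le> v n x" "incseq v"
    "\<And>n. \<exists>K. compact K \<and> (\<forall>x. x \<notin> K \<longrightarrow> v n x = 0)"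
    "\<And>x. (SUP n. ennreal (v n x)) = indicator U x"
    by (rule open_eq_SUP_continuous_compact_support[OF locally_compact assms]) (rule that; assumption)
  have "disintegrates (\<lambda>x. SUP n. ennreal (v n x))"
  proof (rule disintegrates_SUP)
    show "disintegrates (\<lambda>x. ennreal (v n x))" for n
      using v(1,2,4) disintegrates_continuous by blast
    show "incseq (\<lambda>n x. ennreal (v n x))"
      using v(3) by (auto simp: incseq_def le_fun_def intro: ennreal_leI)
  qed
  then show ?thesis by (simp add: v(5))
qed

lemma disintegrates_zero: "disintegrates (\<lambda>_. 0)"
proof -
  have "(indicator {} :: 'g \<Rightarrow> ennreal) = (\<lambda>_. 0)" by auto
  with disintegrates_open[of "{}"] show ?thesis by simp
qed

text \<open>Dynkin's argument with the open sets as intersection-stable generator. Intersecting with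
  a relatively compact \<open>V\<close> makes complements differences of finite quantities, and
  openness of \<open>V\<close> keeps the generators open.\<close>

lemma disintegrates_borel_inter_open:
  assumes "A \<in> sets borel" "open V" "V \<subseteq> K" "compact K"
  shows "disintegrates (indicator (A \<inter> V))"
proof -
  have fin: "(\<integral>\<^sup>+x. indicator (B \<inter> V) (x + g) \<partial>mH) < \<infinity>" "(\<integral>\<^sup>+x. indicator (B \<inter> V) x \<partial>mG) < \<infinity>"
    if [measurable]: "B \<in> sets borel" for B g
  proof -
    have [measurable]: "V \<in> sets borel" using assms(2) by simp
    have le: "indicator (B \<inter> V) x \<le> (1::ennreal) * indicator K x" for x
      using assms(3) by (auto simp: indicator_def)
    show "(\<integral>\<^sup>+x. indicator (B \<inter> V) (x + g) \<partial>mH) < \<infinity>"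
      by (rule nn_integral_coset_finite[OF assms(4) _ le]) auto
    show "(\<integral>\<^sup>+x. indicator (B \<inter> V) x \<partial>mG) < \<infinity>"
      using G.nn_integral_coset_finite[OF assms(4) _ le, of 0] by simp
  qed
  have "Int_stable {S::'g set. open S}" "{S::'g set. open S} \<subseteq> Pow UNIV" "A \<in> sigma_sets UNIV {S. open S}"
    using assms(1) by (auto simp: Int_stable_def borel_def)
  then show ?thesis
  proof (induction rule: sigma_sets_induct_disjoint)
    case (basic A)
    then show ?case using assms(2) by (intro disintegrates_open) auto
  next
    case empty
    then show ?case using disintegrates_zero by (simp add: indicator_def[abs_def])
  next
    case (compl A)
    then have A: "A \<in> sets borel" by (simp add: borel_def)
    have "indicator ((UNIV - A) \<inter> V) = (\<lambda>x. indicator V x - indicator (A \<inter> V) x :: ennreal)"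
      by (auto simp: indicator_def)
    then show ?case
      using disintegrates_diff[OF compl(2) disintegrates_open[OF assms(2)]] fin[OF A]
      by (simp add: fibre_integral_def indicator_def)
  next
    case (union A)
    define U :: "nat \<Rightarrow> 'g \<Rightarrow> ennreal" where "U n x = (\<Sum>i<n. indicator (A i \<inter> V) x)" for n x
    have "disintegrates (\<lambda>x. SUP n. U n x)"
    proof (rule disintegrates_SUP)
      show "disintegrates (U n)" for n
      proof (induction n)
        case 0
        then show ?case using disintegrates_zero by (simp add: U_def[abs_def])
      next
        case (Suc n)
        then show ?case
          using disintegrates_add[OF Suc union(3)[of n]] by (simp add: U_def[abs_def])
      qed
      show "incseq U"
        by (intro incseq_SucI) (simp add: U_def le_fun_def)
    qed
    moreover have "(SUP n. U n x) = indicator (\<Union>(range A) \<inter> V) x" for x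
    proof -
      have "disjoint_family (\<lambda>i. A i \<inter> V)"
        using union(1) by (auto simp: disjoint_family_on_def)
      then have "(\<Sum>i. indicator (A i \<inter> V) x :: ennreal) = indicator (\<Union>i. A i \<inter> V) x"
        by (rule suminf_indicator)
      then show ?thesis by (simp add: suminf_eq_SUP U_def)
    qed
    ultimately show ?case by simp
  qed
qed

text \<open>Removes the localization: finite unions of translates of \<open>interior W\<close> are
  relatively compact open sets increasing to G.\<close>

lemma disintegrates_set:
  assumes "A \<in> sets borel"
  shows "disintegrates (indicator A)"
proof -
  obtain W :: "'g set" where W: "compact W" "0 \<in> interior W"
    by (rule locally_compact_group_nhd[OF locally_compact])
  obtain D where D: "countable D" "UNIV \<subseteq> (\<Union>g\<in>D. (+) g ` interior W)"
    using countable_translate_cover[OF open_interior W(2), of UNIV] by auto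
  then have "D \<noteq> {}" by auto
  then obtain d :: "nat \<Rightarrow> 'g" where d: "range d = D"
    using D(1) by (metis uncountable_def)
  define V where "V n = (\<Union>i\<le>n. (+) (d i) ` interior W)" for n
  have "disintegrates (\<lambda>x. SUP n. indicator (A \<inter> V n) x)"
  proof (rule disintegrates_SUP)
    fix n
    show "disintegrates (indicator (A \<inter> V n))"
    proof (rule disintegrates_borel_inter_open[OF assms])
      show "open (V n)"
        unfolding V_def by (auto intro!: open_left_translate)
      show "V n \<subseteq> (\<Union>i\<le>n. (+) (d i) ` W)"
        unfolding V_def using interior_subset[of W] by blast
      show "compact (\<Union>i\<le>n. (+) (d i) ` W)"
        using W(1) by (intro compact_UN) (auto intro: compact_left_translate)
    qed
  next
    show "incseq (\<lambda>n. indicator (A \<inter> V n) :: 'g \<Rightarrow> ennreal)"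
      by (force simp: incseq_def le_fun_def indicator_def V_def)
  qed
  moreover have "(SUP n. indicator (A \<inter> V n) x :: ennreal) = indicator A x" for x
  proof -
    have "x \<in> (\<Union>g\<in>D. (+) g ` interior W)" using D(2) by blast
    then obtain n where "x \<in> V n" using d unfolding V_def by blast
    then show ?thesis
      by (intro antisym SUP_least) (auto simp: indicator_def intro!: SUP_upper2[of n])
  qed
  ultimately show ?thesis by simp
qed

theorem disintegrates_borel:
  assumes "u \<in> borel_measurable borel"
  shows "disintegrates u"
  using assms
proof (induction rule: borel_measurable_induct)
  case (cong f g)
  then have "f = g" by auto
  with cong show ?case by simp
next
  case (seq U)
  then show ?case using disintegrates_SUP[of U] by (simp add: image_image SUP_apply[abs_def])
qed (simp_all add: disintegrates_set disintegrates_cmult disintegrates_add)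

text \<open>
  The fibre integral of \<open>1\<^bsub>B\<^esub>\<close> with \<open>B\<close> the preimage of \<open>A\<close> is \<open>mH(H) 1\<^bsub>A\<^esub>\<close>.
\<close>

lemma sets_quotientI:
  assumes "A \<subseteq> space mHG" and [measurable]: "right_coset H -` A \<in> sets borel"
  shows "A \<in> sets mHG"
proof -
  let ?q = "fibre_integral (indicator (right_coset H -` A))"
  have [measurable]: "?q \<in> borel_measurable mHG"
    using disintegrates_borel[of "indicator (right_coset H -` A)"] by (simp add: disintegrates_def)
  have "?q (right_coset H g) = indicator A (right_coset H g) * emeasure mH H" for g
  proof -
    have "?q (right_coset H g) = (\<integral>\<^sup>+h. indicator A (right_coset H g) \<partial>mH)"
      by (subst fibre_integral_right_coset, measurable, intro nn_integral_cong)
         (simp add: indicator_def space_eq right_coset_add)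
    then show ?thesis by (simp add: space_eq)
  qed
  \<comment> \<open>The mass of H may be infinite, so \<open>A\<close> is recovered from positivity
    alone, using 0 times infinity = 0 off \<open>A\<close>.\<close>
  then have "0 < ?q (right_coset H g) \<longleftrightarrow> right_coset H g \<in> A" for g
    using emeasure_space_pos by (cases "right_coset H g \<in> A") simp_all
  then have "A = {c \<in> space mHG. 0 < ?q c}"
    using assms(1) by (auto simp: space_quotient)
  also have "\<dots> \<in> sets mHG" by measurable
  finally show ?thesis .
qed

lemma on_coset_measurable:
  fixes u :: "'g \<Rightarrow> 'b::topological_space"
  assumes "u \<in> borel_measurable borel" and "\<And>h g. h \<in> H \<Longrightarrow> u (h + g) = u g"
  shows "on_coset u \<in> borel_measurable mHG"
proof (rule measurableI)
  fix S :: "'b set" assume S: "S \<in> sets borel"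
  have "right_coset H -` (on_coset u -` S \<inter> space mHG) = u -` S \<inter> space borel"
    using on_coset_right_coset[where u = u, OF subgroup] assms(2) by (auto simp: space_quotient)
  also have "\<dots> \<in> sets borel"
    using assms(1) S by (rule measurable_sets)
  finally show "on_coset u -` S \<inter> space mHG \<in> sets mHG"
    by (intro sets_quotientI) auto
qed simp

section \<open>Weights on G and integrals over the coset space\<close>

definition saturation :: "'g set \<Rightarrow> 'g set" where
  "saturation C = (\<lambda>(x, y). x + y) ` (H \<times> C)"

lemma saturation_eq: "saturation C = right_coset H -` right_coset H ` C"
  by (simp add: saturation_def right_coset_vimage_image)

lemma saturation_add_iff: "h \<in> H \<Longrightarrow> h + g \<in> saturation C \<longleftrightarrow> g \<in> saturation C"
  by (simp add: saturation_eq right_coset_add)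

lemma saturation_sets: "compact C \<Longrightarrow> saturation C \<in> sets borel"
  unfolding saturation_def by (intro borel_closed closed_plus_compact closed)

text \<open>
  With \<open>U = W + C\<close> for a compact neighbourhood \<open>W\<close> of the identity, the function
  \<open>w(g) = mH(H \<inter> Ug\<inverse>)\<close> is at least \<open>mH(H \<inter> W) > 0\<close> on \<open>HC\<close>, so \<open>1\<^bsub>U \<inter> HC\<^esub> / w\<close> is bounded.
\<close>

lemma bruhat_function:
  assumes C: "compact C"
  obtains \<rho> :: "'g \<Rightarrow> real" and B U where "\<rho> \<in> borel_measurable borel" "\<And>g. 0 \<le> \<rho> g" "\<And>g. \<rho> g \<le> B"
    "compact U" "\<And>g. g \<notin> U \<Longrightarrow> \<rho> g = 0"
    "\<And>g. (\<integral>\<^sup>+h. \<rho> (h + g) \<partial>mH) = indicator (saturation C) g"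
proof -
  interpret sigma_finite_measure mH by (rule sigma_finite)
  obtain W :: "'g set" where W: "compact W" "0 \<in> interior W"
    by (rule locally_compact_group_nhd[OF locally_compact])
  have [measurable]: "W \<in> sets borel" using W(1) by (intro borel_closed compact_imp_closed)
  define U where "U = (\<lambda>(x, y). x + y) ` (W \<times> C)"
  have U: "compact U" unfolding U_def by (intro compact_set_plus W C)
  then have [measurable]: "U \<in> sets borel" by (intro borel_closed compact_imp_closed)
  have [measurable]: "saturation C \<in> sets borel" by (rule saturation_sets[OF C])
  define w where "w g = (\<integral>\<^sup>+h. indicator U (h + g) \<partial>mH)" for g
  have w_measurable [measurable]: "w \<in> borel_measurable borel"
    unfolding w_def[abs_def] by measurable
  have w_add: "w (h + g) = w g" if "h \<in> H" for h g
    unfolding w_def by (rule nn_integral_coset[OF that]) measurable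
  have w_fin: "w g < \<infinity>" for g
    unfolding w_def by (rule nn_integral_coset_finite[OF U, of _ 1]) auto
  define \<epsilon> where "\<epsilon> = emeasure mH (W \<inter> H)"
  have \<epsilon>: "0 < \<epsilon>" "\<epsilon> < \<infinity>"
    using emeasure_nhd_pos[OF _ W(2)] emeasure_compact[OF W(1)] by (simp_all add: \<epsilon>_def)
  have w_ge: "\<epsilon> \<le> w g" if sat: "g \<in> saturation C" for g
  proof -
    obtain h c where g: "g = h + c" "h \<in> H" "c \<in> C"
      using sat by (auto simp: saturation_def)
    have "\<epsilon> = (\<integral>\<^sup>+k. indicator W (k + 0) \<partial>mH)"
      unfolding \<epsilon>_def by (subst nn_integral_indicator_right) auto
    also have "\<dots> \<le> (\<integral>\<^sup>+k. indicator U (k + c) \<partial>mH)"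
      using g(3) by (intro nn_integral_mono) (auto simp: indicator_def U_def)
    also have "\<dots> = w g"
      using w_add[OF g(2), of c] by (simp add: g w_def)
    finally show ?thesis .
  qed
  have w_real: "0 < enn2real \<epsilon>" "enn2real \<epsilon> \<le> enn2real (w g)" if "g \<in> saturation C" for g
    using w_ge[OF that] w_fin[of g] \<epsilon> by (auto intro: enn2real_mono simp: enn2real_positive_iff)
  \<comment> \<open>Away from HC, \<open>w\<close> may be arbitrarily small or 0. Cutting off by the
    H-invariant set HC avoids this and leaves the normalization along each coset of HC intact, since
    \<open>w\<close> is constant there.\<close>
  define \<rho> where "\<rho> g = indicator (U \<inter> saturation C) g / enn2real (w g)" for g
  show thesis
  proof
    show [measurable]: "\<rho> \<in> borel_measurable borel"
      unfolding \<rho>_def[abs_def] by measurable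
    show "0 \<le> \<rho> g" for g by (simp add: \<rho>_def)
    show "\<rho> g \<le> 1 / enn2real \<epsilon>" for g
      using w_real[of g] by (auto simp: \<rho>_def indicator_def intro!: divide_left_mono)
    show "compact U" by fact
    show "\<rho> g = 0" if "g \<notin> U" for g using that by (simp add: \<rho>_def)
    show "(\<integral>\<^sup>+h. \<rho> (h + g) \<partial>mH) = indicator (saturation C) g" for g
    proof (cases "g \<in> saturation C")
      case False
      then have "(\<integral>\<^sup>+h. \<rho> (h + g) \<partial>mH) = (\<integral>\<^sup>+h. 0 \<partial>mH)"
        by (intro nn_integral_cong) (simp add: space_eq \<rho>_def saturation_add_iff)
      with False show ?thesis by simp
    next
      case True
      let ?r = "enn2real (w g)"
      have r: "0 < ?r" using w_real[OF True] by simp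
      have "(\<integral>\<^sup>+h. \<rho> (h + g) \<partial>mH) = (\<integral>\<^sup>+h. ennreal (1 / ?r) * indicator U (h + g) \<partial>mH)"
        using True by (intro nn_integral_cong)
          (simp add: space_eq \<rho>_def saturation_add_iff w_add indicator_def)
      also have "\<dots> = ennreal (1 / ?r) * w g"
        unfolding w_def by (rule nn_integral_cmult) measurable
      also have "\<dots> = ennreal (1 / ?r) * ennreal ?r"
        using w_fin[of g] by (simp add: ennreal_enn2real)
      also have "\<dots> = 1"
        using r by (simp flip: ennreal_mult)
      finally show ?thesis using True by simp
    qed
  qed
qed

text \<open>The extended formula applied to \<rho>(g) times the indicator of \<open>A\<close> at the
  coset of g. As an equality of measures it moves complex integrals from the coset space to G
  without splitting into nonnegative parts.\<close>

lemma density_quotient_eq_distr: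
  assumes C: "compact C" and [measurable]: "\<rho> \<in> borel_measurable borel"
    and \<rho>: "\<And>g. (\<integral>\<^sup>+h. ennreal (\<rho> (h + g)) \<partial>mH) = indicator (saturation C) g"
  shows "density mHG (indicator (right_coset H ` C)) = distr (density mG \<rho>) mHG (right_coset H)"
proof (rule measure_eqI)
  have [measurable]: "right_coset H ` C \<in> sets mHG" by (rule compact_image_sets[OF C])
  have \<rho>_mG [measurable]: "\<rho> \<in> borel_measurable mG"
    using measurable_cong_sets[OF sets_mG refl] by simp
  fix A assume "A \<in> sets (density mHG (indicator (right_coset H ` C)))"
  then have A [measurable]: "A \<in> sets mHG" by simp
  let ?u = "\<lambda>g. ennreal (\<rho> g) * indicator A (right_coset H g)"
  have u [measurable]: "?u \<in> borel_measurable borel"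
    by measurable
  have q: "fibre_integral ?u (right_coset H g) = indicator (right_coset H ` C) (right_coset H g) * indicator A (right_coset H g)" for g
  proof -
    have "fibre_integral ?u (right_coset H g) = (\<integral>\<^sup>+h. ennreal (\<rho> (h + g)) * indicator A (right_coset H g) \<partial>mH)"
      unfolding fibre_integral_right_coset[OF u]
      by (intro nn_integral_cong) (simp add: space_eq right_coset_add)
    also have "\<dots> = indicator (saturation C) g * indicator A (right_coset H g)"
      by (subst nn_integral_multc) (simp_all add: \<rho>)
    finally show ?thesis by (simp add: saturation_eq indicator_def)
  qed
  have "emeasure (distr (density mG \<rho>) mHG (right_coset H)) A =
      emeasure (density mG \<rho>) (right_coset H -` A \<inter> space mG)"
    by (subst emeasure_distr) auto
  also have "\<dots> = (\<integral>\<^sup>+g. ?u g \<partial>mG)"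
    by (subst emeasure_density) (auto intro!: nn_integral_cong simp: indicator_def)
  also have "\<dots> = (\<integral>\<^sup>+c. fibre_integral ?u c \<partial>mHG)"
    using disintegrates_borel[OF u] by (simp add: disintegrates_def)
  also have "\<dots> = (\<integral>\<^sup>+c. indicator (right_coset H ` C) c * indicator A c \<partial>mHG)"
    by (intro nn_integral_cong) (auto simp: space_quotient q)
  also have "\<dots> = emeasure (density mHG (indicator (right_coset H ` C))) A"
    by (simp add: emeasure_density)
  finally show "emeasure (density mHG (indicator (right_coset H ` C))) A =
      emeasure (distr (density mG \<rho>) mHG (right_coset H)) A" ..
qed simp

lemma integral_on_coset:
  fixes u :: "'g \<Rightarrow> complex"
  assumes C: "compact C" and [measurable]: "\<rho> \<in> borel_measurable borel" and \<rho>0: "\<And>g. 0 \<le> \<rho> g"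
    and \<rho>: "\<And>g. (\<integral>\<^sup>+h. ennreal (\<rho> (h + g)) \<partial>mH) = indicator (saturation C) g"
    and u: "u \<in> borel_measurable borel" "\<And>h g. h \<in> H \<Longrightarrow> u (h + g) = u g"
    and u0: "\<And>g. g \<notin> saturation C \<Longrightarrow> u g = 0"
  shows "(\<integral>c. on_coset u c \<partial>mHG) = (\<integral>g. \<rho> g * u g \<partial>mG)"
proof -
  have [measurable]: "right_coset H ` C \<in> sets mHG" by (rule compact_image_sets[OF C])
  have [measurable]: "\<rho> \<in> borel_measurable mG"
    using measurable_cong_sets[OF sets_mG refl] by simp
  have [measurable]: "on_coset u \<in> borel_measurable mHG"
    by (rule on_coset_measurable[OF u])
  have v: "on_coset u (right_coset H g) = u g" for g
    using u(2) by (intro on_coset_right_coset[where u = u, OF subgroup])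
  have "(\<integral>c. on_coset u c \<partial>mHG) = (\<integral>c. indicator (right_coset H ` C) c *\<^sub>R on_coset u c \<partial>mHG)"
  proof (rule Bochner_Integration.integral_cong[OF refl])
    fix c assume "c \<in> space mHG"
    then obtain g where g: "c = right_coset H g" by (auto simp: space_quotient)
    show "on_coset u c = indicator (right_coset H ` C) c *\<^sub>R on_coset u c"
    proof (cases "c \<in> right_coset H ` C")
      case False
      then have "u g = 0" by (intro u0) (simp add: saturation_eq g)
      then show ?thesis by (simp add: g v)
    qed simp
  qed
  also have "\<dots> = (\<integral>c. on_coset u c \<partial>density mHG (\<lambda>c. ennreal (indicator (right_coset H ` C) c)))"
    by (rule integral_density[symmetric]) auto
  also have "\<dots> = (\<integral>c. on_coset u c \<partial>distr (density mG \<rho>) mHG (right_coset H))"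
    using density_quotient_eq_distr[OF C _ \<rho>] by (simp add: ennreal_indicator)
  also have "\<dots> = (\<integral>g. on_coset u (right_coset H g) \<partial>density mG \<rho>)"
    by (rule integral_distr) measurable
  also have "\<dots> = (\<integral>g. \<rho> g *\<^sub>R on_coset u (right_coset H g) \<partial>mG)"
    by (rule integral_density) (auto simp: \<rho>0)
  finally show ?thesis by (simp add: v scaleR_conv_of_real)
qed

lemma integrable_on_coset:
  fixes u :: "'g \<Rightarrow> complex"
  assumes C: "compact C"
    and u: "u \<in> borel_measurable borel" "\<And>h g. h \<in> H \<Longrightarrow> u (h + g) = u g"
    and u0: "\<And>g. g \<notin> saturation C \<Longrightarrow> u g = 0" and B: "\<And>g. cmod (u g) \<le> B"
  shows "integrable mHG (on_coset u)"
proof (rule integrableI_bounded_set[OF compact_image_sets[OF C] on_coset_measurable[OF u] emeasure_compact_image[OF C]])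
  have v: "on_coset u (right_coset H g) = u g" for g
    using u(2) by (intro on_coset_right_coset[where u = u, OF subgroup])
  show "AE c in mHG. c \<in> right_coset H ` C \<longrightarrow> cmod (on_coset u c) \<le> B"
    using B by (intro AE_I2) (auto simp: space_quotient v)
  show "AE c in mHG. c \<notin> right_coset H ` C \<longrightarrow> on_coset u c = 0"
  proof (intro AE_I2 impI)
    fix c assume "c \<in> space mHG" and c: "c \<notin> right_coset H ` C"
    then obtain g where g: "c = right_coset H g" by (auto simp: space_quotient)
    with c have "u g = 0" by (intro u0) (simp add: saturation_eq)
    then show "on_coset u c = 0" by (simp add: g v)
  qed
qed

lemma integral_uminus:
  fixes u :: "'g \<Rightarrow> complex"
  assumes [measurable]: "u \<in> borel_measurable borel"
  shows "(\<integral>g. u (- g) \<partial>mG) = (\<integral>g. u g \<partial>mG)"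
proof -
  have m [measurable]: "uminus \<in> mG \<rightarrow>\<^sub>M borel"
    unfolding measurable_cong_sets[OF sets_mG refl] by (rule borel_measurable_group_uminus) simp
  have "distr mG borel uminus = mG"
  proof (rule measure_eqI)
    fix A assume "A \<in> sets (distr mG borel uminus)"
    then have [measurable]: "A \<in> sets borel" by simp
    then have A: "A \<in> sets mG" by (simp add: sets_mG)
    have "emeasure (distr mG borel uminus) A = (\<integral>\<^sup>+g. indicator A (- g) \<partial>mG)"
      by (subst nn_integral_indicator[symmetric], simp) (subst nn_integral_distr, auto)
    also have "\<dots> = (\<integral>\<^sup>+g. indicator A g \<partial>mG)"
      by (rule G.nn_integral_uminus) measurable
    finally show "emeasure (distr mG borel uminus) A = emeasure mG A"
      using A by simp
  qed (simp add: sets_mG)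
  then show ?thesis
    using integral_distr[OF m assms] by simp
qed

end

section \<open>Transverse systems\<close>

locale transverse_eigenfunction = homogeneous_space H mG mH mHG
  for H :: "'g::{topological_group_add, t2_space, second_countable_topology} set" and mG mH mHG +
  fixes M \<mu> \<sigma> :: "'x measure" and act :: "'g \<Rightarrow> 'x \<Rightarrow> 'x" and Y :: "'x set"
    and \<xi> :: "'g \<Rightarrow> complex" and \<psi> :: "'x \<Rightarrow> complex"
  assumes system: "integrable_transverse_system M act H Y \<mu>"
    and transverse: "transverse_measure M act H Y \<mu> mG mH \<sigma>"
    and character: "unitary_character H \<xi>"
    and eigen: "eigenfunction M act H Y \<xi> \<psi>"
begin

lemma act_measurable: "(\<lambda>(g, x). act g x) \<in> borel \<Otimes>\<^sub>M M \<rightarrow>\<^sub>M M"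
  and act_zero: "x \<in> space M \<Longrightarrow> act 0 x = x"
  and act_add: "x \<in> space M \<Longrightarrow> act (g + h) x = act g (act h x)"
  and Y_sets: "Y \<in> sets M"
  and sets_\<mu>: "sets \<mu> = sets M"
  using system by (auto simp: integrable_transverse_system_def transverse_system_def
      standard_borel_G_space_def cross_section_def)

lemma act_H: "h \<in> H \<Longrightarrow> y \<in> Y \<Longrightarrow> act h y \<in> Y"
  using system unfolding integrable_transverse_system_def transverse_system_def cross_section_def
  by blast

lemma sets_\<sigma>: "sets \<sigma> = sets (restrict_space M Y)"
  and finite_\<sigma>: "finite_measure \<sigma>"
  and distr_\<sigma>: "h \<in> H \<Longrightarrow> distr \<sigma> \<sigma> (act h) = \<sigma>"
  using transverse by (auto simp: transverse_measure_def)

lemma Y_subset: "Y \<subseteq> space M"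
  using Y_sets by (rule sets.sets_into_space)

lemma space_restrict_Y: "space (restrict_space M Y) = Y"
  using Y_subset by (auto simp: space_restrict_space)

lemma space_\<sigma>: "space \<sigma> = Y"
  using sets_eq_imp_space_eq[OF sets_\<sigma>] by (simp add: space_restrict_Y)

lemma space_\<mu>: "space \<mu> = space M"
  by (rule sets_eq_imp_space_eq[OF sets_\<mu>])

lemma act_measurable_right: "act g \<in> M \<rightarrow>\<^sub>M M"
  using measurable_compose[OF measurable_Pair1' act_measurable, of g] by simp

lemma act_space: "x \<in> space M \<Longrightarrow> act g x \<in> space M"
  by (rule measurable_space[OF act_measurable_right])

lemma act_minus: "x \<in> space M \<Longrightarrow> act (- g) (act g x) = x"
  by (simp add: act_add[symmetric] act_zero)

lemma id_restrict: "(\<lambda>y. y) \<in> restrict_space M Y \<rightarrow>\<^sub>M M"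
  by (rule measurable_restrict_space1) simp

lemma act_measurable_Y: "(\<lambda>(g, y). act g y) \<in> borel \<Otimes>\<^sub>M restrict_space M Y \<rightarrow>\<^sub>M M"
proof -
  have "(\<lambda>p. (fst p, snd p)) \<in> borel \<Otimes>\<^sub>M restrict_space M Y \<rightarrow>\<^sub>M borel \<Otimes>\<^sub>M M"
    by (intro measurable_Pair measurable_fst measurable_compose[OF measurable_snd id_restrict])
  from measurable_compose[OF this act_measurable] show ?thesis by (simp add: case_prod_beta)
qed

lemma \<psi>_measurable: "\<psi> \<in> borel_measurable (restrict_space M Y)"
  and \<psi>_bounded: "bounded (\<psi> ` Y)"
  and \<psi>_minus: "h \<in> H \<Longrightarrow> y \<in> Y \<Longrightarrow> \<psi> (act (- h) y) = \<xi> h * \<psi> y"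
  using eigen by (auto simp: eigenfunction_def)

lemma \<xi>_cnj: "h \<in> H \<Longrightarrow> \<xi> h * cnj (\<xi> h) = 1"
  using character by (simp add: unitary_character_def complex_norm_square[symmetric])

lemma \<xi>_minus:
  assumes "h \<in> H"
  shows "\<xi> (- h) = cnj (\<xi> h)"
proof -
  have mult: "\<xi> (k + l) = \<xi> k * \<xi> l" if "k \<in> H" "l \<in> H" for k l
    using character that by (simp add: unitary_character_def)
  have "\<xi> 0 * \<xi> h = \<xi> h" "\<xi> h * \<xi> (- h) = \<xi> 0"
    using mult[OF zero_mem assms] mult[OF assms minus_mem[OF assms]] by simp_all
  moreover have "\<xi> h \<noteq> 0" using \<xi>_cnj[OF assms] by auto
  ultimately have "\<xi> h * \<xi> (- h) = \<xi> h * cnj (\<xi> h)"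
    using \<xi>_cnj[OF assms] by simp
  with \<open>\<xi> h \<noteq> 0\<close> show ?thesis by simp
qed

lemma \<psi>_act: "h \<in> H \<Longrightarrow> y \<in> Y \<Longrightarrow> \<psi> (act h y) = cnj (\<xi> h) * \<psi> y"
  using \<psi>_minus[of "- h" y] \<xi>_minus[of h] minus_mem by simp

text \<open>Moving along the coset multiplies \<open>f\<close> by \<xi>(h) and \<psi> by its
  conjugate, which cancel since \<xi> has modulus 1.\<close>

lemma summand_invariant:
  assumes "\<And>h g. h \<in> H \<Longrightarrow> f (h + g) = \<xi> h * f g"
    and "x \<in> space M" "act g x \<in> Y" "h \<in> H"
  shows "f (h + g) * \<psi> (act (h + g) x) = f g * \<psi> (act g x)"
proof -
  have "f (h + g) * \<psi> (act (h + g) x) = (\<xi> h * cnj (\<xi> h)) * (f g * \<psi> (act g x))"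
    using assms by (simp add: act_add \<psi>_act)
  then show ?thesis using \<xi>_cnj assms(4) by simp
qed

lemma on_coset_summand:
  assumes "\<And>h g. h \<in> H \<Longrightarrow> f (h + g) = \<xi> h * f g" and "x \<in> space M" "act g x \<in> Y"
  shows "on_coset (\<lambda>g. f g * \<psi> (act g x)) (right_coset H g) = f g * \<psi> (act g x)"
  by (intro on_coset_right_coset[where u = "\<lambda>g. f g * \<psi> (act g x)", OF subgroup]
      summand_invariant assms)

section \<open>Induced functions and sums over hitting times\<close>

lemma
  assumes "f \<in> Ind0 H \<xi>"
  shows Ind0_continuous: "continuous_on UNIV f"
    and Ind0_equivariant: "\<And>h g. h \<in> H \<Longrightarrow> f (h + g) = \<xi> h * f g"
  using assms by (auto simp: Ind0_def)

lemma Ind0_measurable: "f \<in> Ind0 H \<xi> \<Longrightarrow> f \<in> borel_measurable borel"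
  by (rule borel_measurable_continuous_onI) (rule Ind0_continuous)

lemma Ind0_cmod: "f \<in> Ind0 H \<xi> \<Longrightarrow> h \<in> H \<Longrightarrow> cmod (f (h + g)) = cmod (f g)"
  using character by (simp add: Ind0_equivariant norm_mult unitary_character_def)

lemma Ind0_support:
  assumes f: "f \<in> Ind0 H \<xi>"
  obtains K where "compactin (coset_topology H) K" "\<And>g. right_coset H g \<notin> K \<Longrightarrow> f g = 0"
proof -
  obtain K where K: "compactin (coset_topology H) K"
      "\<forall>c \<in> right_cosets H - K. on_coset (\<lambda>g. cmod (f g)) c = 0"
    using f by (auto simp: Ind0_def Cc_def topspace_coset_topology)
  have "f g = 0" if "right_coset H g \<notin> K" for g
  proof -
    have "on_coset (\<lambda>g. cmod (f g)) (right_coset H g) = cmod (f g)"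
      by (intro on_coset_right_coset[where u = "\<lambda>g. cmod (f g)", OF subgroup] Ind0_cmod[OF f])
    with K(2) that show ?thesis by (simp add: right_cosets_def)
  qed
  with K(1) show thesis by (rule that)
qed

text \<open>|f| is H-invariant, so a bound on a compact \<open>C\<close> in G whose cosets cover the
  support is a bound everywhere.\<close>

lemma Ind0_compact_support:
  assumes f: "f \<in> Ind0 H \<xi>"
  obtains C B where "compact C" "\<And>g. g \<notin> saturation C \<Longrightarrow> f g = 0" "\<And>g. cmod (f g) \<le> B"
proof -
  obtain K where K: "compactin (coset_topology H) K" "\<And>g. right_coset H g \<notin> K \<Longrightarrow> f g = 0"
    by (rule Ind0_support[OF f]) (rule that; assumption)
  obtain C where C: "compact C" "K \<subseteq> right_coset H ` C"
    using compactin_covered[OF K(1)] .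
  have supp: "f g = 0" if "g \<notin> saturation C" for g
    using that C(2) K(2) by (auto simp: saturation_eq)
  have "bounded (f ` C)"
    by (intro compact_imp_bounded compact_continuous_image C)
       (rule continuous_on_subset[OF Ind0_continuous[OF f]], simp)
  then obtain B where B: "\<And>c. c \<in> C \<Longrightarrow> cmod (f c) \<le> B"
    by (auto simp: bounded_iff)
  \<comment> \<open>If \<open>C\<close> is empty, \<open>B\<close> is arbitrary and may be
    negative.\<close>
  have "cmod (f g) \<le> max B 0" for g
  proof (cases "g \<in> saturation C")
    case True
    then obtain h c where "g = h + c" "h \<in> H" "c \<in> C" by (auto simp: saturation_def)
    then show ?thesis using Ind0_cmod[OF f] B[of c] by simp
  qed (simp add: supp)
  with C(1) supp show thesis by (rule that)
qed

lemma AE_finite_hitting_times: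
  assumes "compactin (coset_topology H) K"
  shows "AE x in \<mu>. finite (hitting_times act H Y x \<inter> K)"
proof -
  let ?n = "\<lambda>x. emeasure (count_space UNIV) (hitting_times act H Y x \<inter> K)"
  have "AE x in completion \<mu>. ?n x \<noteq> \<infinity>"
    using system assms by (intro nn_integral_PInf_AE) (auto simp: integrable_transverse_system_def)
  then have "AE x in \<mu>. ?n x \<noteq> \<infinity>" by (simp only: AE_completion_iff)
  then show ?thesis by eventually_elim (auto simp: emeasure_count_space split: if_splits)
qed

text \<open>Only hitting times in the compact support contribute, and by integrability of the system
  almost every x has finitely many. Without summability \<open>infsum\<close> defaults to 0 and
  additivity of S can fail, which is why linearity is an almost everywhere statement.\<close>

lemma AE_summable:
  assumes f: "f \<in> Ind0 H \<xi>"
  shows "AE x in \<mu>. (\<lambda>c. on_coset (\<lambda>g. f g * \<psi> (act g x)) c) summable_on hitting_times act H Y x"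
proof -
  obtain K where K: "compactin (coset_topology H) K" "\<And>g. right_coset H g \<notin> K \<Longrightarrow> f g = 0"
    by (rule Ind0_support[OF f]) (rule that; assumption)
  from AE_finite_hitting_times[OF K(1)] AE_space show ?thesis
  proof eventually_elim
    case (elim x)
    have "on_coset (\<lambda>g. f g * \<psi> (act g x)) c = 0" if "c \<in> hitting_times act H Y x - K" for c
    proof -
      obtain g where g: "c = right_coset H g" "act g x \<in> Y"
        using \<open>c \<in> _\<close> by (auto simp: hitting_times_def)
      then have "on_coset (\<lambda>g. f g * \<psi> (act g x)) c = f g * \<psi> (act g x)"
        using on_coset_summand[OF Ind0_equivariant[OF f], of x g] elim(2) by (simp add: space_\<mu>)
      also have "f g = 0" using g(1) \<open>c \<in> _\<close> K(2) by simp
      finally show ?thesis by simp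
    qed
    then have "(\<lambda>c. on_coset (\<lambda>g. f g * \<psi> (act g x)) c) summable_on hitting_times act H Y x \<longleftrightarrow>
        (\<lambda>c. on_coset (\<lambda>g. f g * \<psi> (act g x)) c) summable_on (hitting_times act H Y x \<inter> K)"
      by (intro summable_on_cong_neutral) auto
    then show ?case using elim(1) by simp
  qed
qed

lemma S_map_linear:
  assumes f: "f\<^sub>1 \<in> Ind0 H \<xi>" "f\<^sub>2 \<in> Ind0 H \<xi>"
  shows "AE x in \<mu>. S_map act H Y \<psi> (\<lambda>g. a * f\<^sub>1 g + b * f\<^sub>2 g) x =
    a * S_map act H Y \<psi> f\<^sub>1 x + b * S_map act H Y \<psi> f\<^sub>2 x"
  using AE_summable[OF f(1)] AE_summable[OF f(2)] AE_space
proof eventually_elim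
  case (elim x)
  let ?t = "\<lambda>f c. on_coset (\<lambda>g. f g * \<psi> (act g x)) c"
  note eq = Ind0_equivariant[OF f(1)] Ind0_equivariant[OF f(2)]
  have x: "x \<in> space M" using elim(3) by (simp add: space_\<mu>)
  have "?t (\<lambda>g. a * f\<^sub>1 g + b * f\<^sub>2 g) c = a * ?t f\<^sub>1 c + b * ?t f\<^sub>2 c" if "c \<in> hitting_times act H Y x" for c
  proof -
    obtain g where g: "c = right_coset H g" "act g x \<in> Y"
      using \<open>c \<in> _\<close> by (auto simp: hitting_times_def)
    have "?t (\<lambda>g. a * f\<^sub>1 g + b * f\<^sub>2 g) (right_coset H g) = (a * f\<^sub>1 g + b * f\<^sub>2 g) * \<psi> (act g x)"
      by (rule on_coset_summand[OF _ x g(2)]) (simp add: eq algebra_simps)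
    then show ?thesis
      using on_coset_summand[OF eq(1) x g(2)] on_coset_summand[OF eq(2) x g(2)]
      by (simp add: g(1) algebra_simps)
  qed
  then have "S_map act H Y \<psi> (\<lambda>g. a * f\<^sub>1 g + b * f\<^sub>2 g) x =
      (\<Sum>\<^sub>\<infinity>c\<in>hitting_times act H Y x. a * ?t f\<^sub>1 c + b * ?t f\<^sub>2 c)"
    unfolding S_map_def by (rule infsum_cong)
  also have "\<dots> = (\<Sum>\<^sub>\<infinity>c\<in>hitting_times act H Y x. a * ?t f\<^sub>1 c) + (\<Sum>\<^sub>\<infinity>c\<in>hitting_times act H Y x. b * ?t f\<^sub>2 c)"
    using elim(1,2) by (intro infsum_add summable_on_cmult_right)
  finally show ?case by (simp add: S_map_def infsum_cmult_right')
qed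

text \<open>Right multiplication by k is a bijection from the hitting times of x to those of
  k^(-1).x and matches the summands. Reindexing an \<open>infsum\<close> is unconditional, so the
  identity holds at every x.\<close>

lemma S_map_translate:
  assumes f: "f \<in> Ind0 H \<xi>" and x: "x \<in> space M"
  shows "S_map act H Y \<psi> (\<lambda>g. f (g + k)) x = S_map act H Y \<psi> f (act (- k) x)"
proof -
  let ?T = "\<lambda>k c. (\<lambda>x. x + k) ` c" and ?x = "act (- k) x"
  have T: "?T k (right_coset H g) = right_coset H (g + k)" for g k
    by (simp add: right_coset_def image_image add.assoc)
  have act_x: "act (g + k) ?x = act g x" for g
    using act_add[OF x, of "g + k" "- k"] by (simp add: add.assoc)
  have act_x': "act g ?x = act (g + - k) x" for g
    using act_add[OF x, of g "- k"] by simp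
  have bij: "bij_betw (?T k) (hitting_times act H Y x) (hitting_times act H Y ?x)"
  proof (rule bij_betwI[where g = "?T (- k)"])
    show "?T k \<in> hitting_times act H Y x \<rightarrow> hitting_times act H Y ?x"
      unfolding hitting_times_def using T act_x by fastforce
    show "?T (- k) \<in> hitting_times act H Y ?x \<rightarrow> hitting_times act H Y x"
      unfolding hitting_times_def using T act_x' by fastforce
  qed (simp_all add: image_image add.assoc)
  have "on_coset (\<lambda>g. f (g + k) * \<psi> (act g x)) c = on_coset (\<lambda>g. f g * \<psi> (act g ?x)) (?T k c)"
    if "c \<in> hitting_times act H Y x" for c
  proof -
    obtain g where g: "c = right_coset H g" "act g x \<in> Y"
      using \<open>c \<in> _\<close> by (auto simp: hitting_times_def)
    have "on_coset (\<lambda>g. f (g + k) * \<psi> (act g x)) c = f (g + k) * \<psi> (act g x)"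
      unfolding g(1) by (rule on_coset_summand[OF _ x g(2)]) (simp add: Ind0_equivariant[OF f] add.assoc)
    also have "\<dots> = on_coset (\<lambda>g. f g * \<psi> (act g ?x)) (right_coset H (g + k))"
      using on_coset_summand[OF Ind0_equivariant[OF f] act_space[OF x], of "g + k" "- k"] g(2)
      by (simp add: act_x)
    finally show ?thesis by (simp add: g(1) T)
  qed
  then show ?thesis
    unfolding S_map_def infsum_reindex_bij_betw[OF bij, symmetric] by (rule infsum_cong)
qed

section \<open>Boundedness, measurability and equivariance of the adjoint transform\<close>

lemma \<psi>_bound:
  obtains B where "0 \<le> B" "\<And>y. y \<in> Y \<Longrightarrow> cmod (\<psi> y) \<le> B"
proof -
  obtain B where "\<And>y. y \<in> Y \<Longrightarrow> cmod (\<psi> y) \<le> B"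
    using \<psi>_bounded by (auto simp: bounded_iff)
  then have "cmod (\<psi> y) \<le> max B 0" if "y \<in> Y" for y
    using that by (simp add: max.coboundedI1)
  then show thesis using that[of "max B 0"] by simp
qed

lemma bounded_borel_bound:
  assumes "\<phi> \<in> bounded_borel M"
  obtains B where "0 \<le> B" "\<And>x. x \<in> space M \<Longrightarrow> cmod (\<phi> x) \<le> B"
proof -
  obtain B where "\<And>x. x \<in> space M \<Longrightarrow> cmod (\<phi> x) \<le> B"
    using assms by (auto simp: bounded_borel_def bounded_iff)
  then have "cmod (\<phi> x) \<le> max B 0" if "x \<in> space M" for x
    using that by (simp add: max.coboundedI1)
  then show thesis using that[of "max B 0"] by simp
qed

lemma S_adj_integrand_measurable:
  assumes \<phi>: "\<phi> \<in> bounded_borel M"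
  shows "(\<lambda>(g, y). \<phi> (act (- g) y) * cnj (\<psi> y)) \<in> borel_measurable (borel \<Otimes>\<^sub>M \<sigma>)"
proof -
  have [measurable]: "\<phi> \<in> borel_measurable M" using \<phi> by (simp add: bounded_borel_def)
  have [measurable]: "(\<lambda>p::'g \<times> 'x. act (- fst p) (snd p)) \<in> borel \<Otimes>\<^sub>M restrict_space M Y \<rightarrow>\<^sub>M M"
  proof -
    have "(\<lambda>p::'g \<times> 'x. (- fst p, snd p)) \<in> borel \<Otimes>\<^sub>M restrict_space M Y \<rightarrow>\<^sub>M borel \<Otimes>\<^sub>M restrict_space M Y"
      by (intro measurable_Pair borel_measurable_group_uminus measurable_fst measurable_snd)
    from measurable_compose[OF this act_measurable_Y] show ?thesis by simp
  qed
  have [measurable]: "\<psi> \<in> borel_measurable (restrict_space M Y)" by (rule \<psi>_measurable)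
  have "(\<lambda>p. \<phi> (act (- fst p) (snd p)) * cnj (\<psi> (snd p))) \<in> borel_measurable (borel \<Otimes>\<^sub>M restrict_space M Y)"
    by measurable
  moreover have "sets (borel \<Otimes>\<^sub>M \<sigma> :: ('g \<times> 'x) measure) = sets (borel \<Otimes>\<^sub>M restrict_space M Y)"
    using sets_\<sigma> by (intro sets_pair_measure_cong) auto
  ultimately show ?thesis
    by (simp add: case_prod_beta' cong: measurable_cong_sets)
qed

lemma
  assumes \<phi>: "\<phi> \<in> bounded_borel M"
  shows S_adj_integrable: "integrable \<sigma> (\<lambda>y. \<phi> (act (- g) y) * cnj (\<psi> y))"
    and S_adj_measurable: "S_adj act \<sigma> \<psi> \<phi> \<in> borel_measurable borel"
    and S_adj_bounded: "bounded (range (S_adj act \<sigma> \<psi> \<phi>))"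
proof -
  interpret finite_measure \<sigma> by (rule finite_\<sigma>)
  obtain B\<^sub>1 where B1: "0 \<le> B\<^sub>1" "\<And>x. x \<in> space M \<Longrightarrow> cmod (\<phi> x) \<le> B\<^sub>1"
    by (rule bounded_borel_bound[OF \<phi>]) (rule that; assumption)
  obtain B\<^sub>2 where B2: "0 \<le> B\<^sub>2" "\<And>y. y \<in> Y \<Longrightarrow> cmod (\<psi> y) \<le> B\<^sub>2"
    by (rule \<psi>_bound) (rule that; assumption)
  have meas: "(\<lambda>y. \<phi> (act (- g) y) * cnj (\<psi> y)) \<in> borel_measurable \<sigma>" for g
    using measurable_compose[OF measurable_Pair1' S_adj_integrand_measurable[OF \<phi>], of g] by simp
  have bound: "cmod (\<phi> (act (- g) y) * cnj (\<psi> y)) \<le> B\<^sub>1 * B\<^sub>2" if "y \<in> space \<sigma>" for g y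
  proof -
    have "y \<in> Y" using that by (simp add: space_\<sigma>)
    with B1 B2 act_space Y_subset show ?thesis
      by (auto simp: norm_mult intro!: mult_mono)
  qed
  show int: "integrable \<sigma> (\<lambda>y. \<phi> (act (- g) y) * cnj (\<psi> y))" for g
    by (rule integrable_const_bound[OF AE_I2[OF bound] meas])
  show "S_adj act \<sigma> \<psi> \<phi> \<in> borel_measurable borel"
    unfolding S_adj_def[abs_def]
    by (rule borel_measurable_lebesgue_integral) (use S_adj_integrand_measurable[OF \<phi>] in simp)
  have "cmod (S_adj act \<sigma> \<psi> \<phi> g) \<le> B\<^sub>1 * B\<^sub>2 * measure \<sigma> (space \<sigma>)" for g
  proof -
    have "cmod (S_adj act \<sigma> \<psi> \<phi> g) \<le> (\<integral>y. cmod (\<phi> (act (- g) y) * cnj (\<psi> y)) \<partial>\<sigma>)"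
      unfolding S_adj_def by (rule integral_norm_bound)
    also have "\<dots> \<le> (\<integral>y. B\<^sub>1 * B\<^sub>2 \<partial>\<sigma>)"
      by (rule integral_mono[OF integrable_norm[OF int]]) (use bound in simp_all)
    finally show ?thesis by (simp add: mult_ac)
  qed
  then show "bounded (range (S_adj act \<sigma> \<psi> \<phi>))"
    by (auto simp: bounded_iff)
qed

text \<open>H-invariance of \<sigma> allows replacing y by h.y: this turns (hg)^(-1).y into
  g^(-1).y, and the conjugate of \<psi>(h.y) releases the factor \<xi>(h). Thus the transform has
  the same equivariance as \<open>f\<close>, and \<open>f\<close> times its conjugate is
  H-invariant.\<close>

lemma S_adj_equivariant:
  assumes \<phi>: "\<phi> \<in> bounded_borel M" and h: "h \<in> H"
  shows "S_adj act \<sigma> \<psi> \<phi> (h + g) = \<xi> h * S_adj act \<sigma> \<psi> \<phi> g"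
proof -
  have act_h: "act h \<in> \<sigma> \<rightarrow>\<^sub>M \<sigma>"
    unfolding measurable_cong_sets[OF sets_\<sigma> sets_\<sigma>]
    using act_H[OF h] by (intro measurable_restrict_space2 measurable_compose[OF id_restrict act_measurable_right])
      (auto simp: space_restrict_Y)
  have "S_adj act \<sigma> \<psi> \<phi> (h + g) = (\<integral>y. \<phi> (act (- (h + g)) y) * cnj (\<psi> y) \<partial>distr \<sigma> \<sigma> (act h))"
    by (simp add: S_adj_def distr_\<sigma>[OF h])
  also have "\<dots> = (\<integral>y. \<phi> (act (- (h + g)) (act h y)) * cnj (\<psi> (act h y)) \<partial>\<sigma>)"
    by (rule integral_distr[OF act_h]) (rule borel_measurable_integrable[OF S_adj_integrable[OF \<phi>]])
  also have "\<dots> = (\<integral>y. \<xi> h * (\<phi> (act (- g) y) * cnj (\<psi> y)) \<partial>\<sigma>)"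
  proof (rule Bochner_Integration.integral_cong[OF refl])
    fix y assume "y \<in> space \<sigma>"
    then have y: "y \<in> Y" "y \<in> space M" using Y_subset by (auto simp: space_\<sigma>)
    have "act (- (h + g)) (act h y) = act (- g) y"
      using act_add[OF y(2), of "- (h + g)" h] by (simp add: minus_add add.assoc)
    then show "\<phi> (act (- (h + g)) (act h y)) * cnj (\<psi> (act h y)) = \<xi> h * (\<phi> (act (- g) y) * cnj (\<psi> y))"
      by (simp add: \<psi>_act[OF h y(1)])
  qed
  finally show ?thesis by (simp add: S_adj_def)
qed

lemma S_adj_product_invariant:
  assumes "f \<in> Ind0 H \<xi>" "\<phi> \<in> bounded_borel M" "h \<in> H"
  shows "f (h + g) * cnj (S_adj act \<sigma> \<psi> \<phi> (h + g)) = f g * cnj (S_adj act \<sigma> \<psi> \<phi> g)"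
proof -
  have "f (h + g) * cnj (S_adj act \<sigma> \<psi> \<phi> (h + g)) = (\<xi> h * cnj (\<xi> h)) * (f g * cnj (S_adj act \<sigma> \<psi> \<phi> g))"
    using assms by (simp add: Ind0_equivariant S_adj_equivariant)
  then show ?thesis using \<xi>_cnj[OF assms(3)] by simp
qed

section \<open>Unfolding and the adjoint identity\<close>

text \<open>
  The test function in the defining identity of \<open>\<sigma>\<close>. The weight \<open>\<rho>\<close> has integral 1 along each coset
  that meets the support of \<open>f\<close>, so the inner integral returns the summand of \<open>S f\<close>.
\<close>

definition unfolding_function :: "('g \<Rightarrow> real) \<Rightarrow> ('g \<Rightarrow> complex) \<Rightarrow> ('x \<Rightarrow> complex) \<Rightarrow> 'g \<times> 'x \<Rightarrow> complex" where
  "unfolding_function \<rho> f \<phi> = (\<lambda>(g, y). complex_of_real (\<rho> (- g)) * f (- g) * \<psi> y * cnj (\<phi> (act g y)))"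

lemma transverse_sum_unfolding_function:
  assumes f: "f \<in> Ind0 H \<xi>" and f0: "\<And>g. g \<notin> saturation C \<Longrightarrow> f g = 0"
    and [measurable]: "\<rho> \<in> borel_measurable borel" and \<rho>0: "\<And>g. 0 \<le> \<rho> g"
    and \<rho>: "\<And>g. (\<integral>\<^sup>+h. ennreal (\<rho> (h + g)) \<partial>mH) = indicator (saturation C) g"
    and x: "x \<in> space M"
  shows "transverse_sum act H Y mH (unfolding_function \<rho> f \<phi>) x = S_map act H Y \<psi> f x * cnj (\<phi> x)"
proof -
  let ?I = "\<lambda>g. \<integral>h. unfolding_function \<rho> f \<phi> (- (h + g), act (h + g) x) \<partial>mH"
  have I: "?I g = f g * \<psi> (act g x) * cnj (\<phi> x)" if g: "act g x \<in> Y" for g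
  proof -
    have "?I g = (\<integral>h. complex_of_real (\<rho> (h + g)) * (f g * \<psi> (act g x) * cnj (\<phi> x)) \<partial>mH)"
    proof (rule Bochner_Integration.integral_cong[OF refl])
      fix h assume "h \<in> space mH"
      then have h: "h \<in> H" by (simp add: space_eq)
      \<comment> \<open>The second argument (h + g).x is moved back by -(h + g), so \<phi> is
        evaluated at x itself and can leave both the integral and the sum over cosets.\<close>
      have "unfolding_function \<rho> f \<phi> (- (h + g), act (h + g) x) =
          of_real (\<rho> (h + g)) * (f (h + g) * \<psi> (act (h + g) x)) * cnj (\<phi> x)"
        by (simp only: unfolding_function_def prod.case minus_minus act_minus[OF x] mult.assoc)
      also have "f (h + g) * \<psi> (act (h + g) x) = f g * \<psi> (act g x)"
        by (rule summand_invariant[OF Ind0_equivariant[OF f] x g h])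
      finally show "unfolding_function \<rho> f \<phi> (- (h + g), act (h + g) x) =
          of_real (\<rho> (h + g)) * (f g * \<psi> (act g x) * cnj (\<phi> x))"
        by (simp only: mult.assoc)
    qed
    also have "\<dots> = of_real (enn2real (indicator (saturation C) g)) * (f g * \<psi> (act g x) * cnj (\<phi> x))"
      unfolding \<rho>[symmetric] integral_mult_left_zero by (subst integral_coset_eq) (simp_all add: \<rho>0)
    \<comment> \<open>Off HC the weight integrates to 0 instead of 1, which is harmless because
      \<open>f\<close> vanishes there.\<close>
    finally show ?thesis
      using f0[of g] by (cases "g \<in> saturation C") simp_all
  qed
  have "on_coset ?I c = on_coset (\<lambda>g. f g * \<psi> (act g x)) c * cnj (\<phi> x)" if "c \<in> hitting_times act H Y x" for c
  proof -
    obtain g where g: "c = right_coset H g" "act g x \<in> Y"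
      using \<open>c \<in> _\<close> by (auto simp: hitting_times_def)
    have "on_coset ?I (right_coset H g) = ?I g"
    proof (rule on_coset_right_coset[where u = ?I, OF subgroup])
      fix h assume h: "h \<in> H"
      have "act (h + g) x \<in> Y"
        using act_H[OF h g(2)] by (simp add: act_add[OF x])
      then show "?I (h + g) = ?I g"
        unfolding I[OF g(2)] I[OF \<open>act (h + g) x \<in> Y\<close>]
        using summand_invariant[OF Ind0_equivariant[OF f] x g(2) h] by simp
    qed
    also have "\<dots> = f g * \<psi> (act g x) * cnj (\<phi> x)"
      by (rule I[OF g(2)])
    also have "\<dots> = on_coset (\<lambda>g. f g * \<psi> (act g x)) (right_coset H g) * cnj (\<phi> x)"
      by (simp only: on_coset_summand[of f x g, OF Ind0_equivariant[OF f] x g(2)])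
    finally show ?thesis by (simp only: g(1))
  qed
  then have "transverse_sum act H Y mH (unfolding_function \<rho> f \<phi>) x =
      (\<Sum>\<^sub>\<infinity>c\<in>hitting_times act H Y x. on_coset (\<lambda>g. f g * \<psi> (act g x)) c * cnj (\<phi> x))"
    unfolding transverse_sum_def by (rule infsum_cong)
  then show ?thesis by (simp add: S_map_def infsum_cmult_left')
qed

lemma unfolding_function_admissible:
  assumes f: "f \<in> Ind0 H \<xi>" and \<phi>: "\<phi> \<in> bounded_borel M"
    and [measurable]: "\<rho> \<in> borel_measurable borel" and \<rho>0: "\<And>g. 0 \<le> \<rho> g" and \<rho>B: "\<And>g. \<rho> g \<le> B"
    and U: "compact U" "\<And>g. g \<notin> U \<Longrightarrow> \<rho> g = 0"
  shows "unfolding_function \<rho> f \<phi> \<in> borel_measurable (borel \<Otimes>\<^sub>M restrict_space M Y)"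
    and "bounded (unfolding_function \<rho> f \<phi> ` (UNIV \<times> Y))"
    and "\<exists>L. compact L \<and> (\<forall>g y. g \<notin> L \<and> y \<in> Y \<longrightarrow> unfolding_function \<rho> f \<phi> (g, y) = 0)"
proof -
  have [measurable]: "\<phi> \<in> borel_measurable M" using \<phi> by (simp add: bounded_borel_def)
  have [measurable]: "(\<lambda>p::'g \<times> 'x. act (fst p) (snd p)) \<in> borel \<Otimes>\<^sub>M restrict_space M Y \<rightarrow>\<^sub>M M"
    using act_measurable_Y by (simp add: case_prod_beta')
  have [measurable]: "\<psi> \<in> borel_measurable (restrict_space M Y)" by (rule \<psi>_measurable)
  have [measurable]: "f \<in> borel_measurable borel" by (rule Ind0_measurable[OF f])
  show "unfolding_function \<rho> f \<phi> \<in> borel_measurable (borel \<Otimes>\<^sub>M restrict_space M Y)"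
    unfolding unfolding_function_def case_prod_beta' by measurable
  obtain B\<^sub>1 where B1: "0 \<le> B\<^sub>1" "\<And>x. x \<in> space M \<Longrightarrow> cmod (\<phi> x) \<le> B\<^sub>1"
    by (rule bounded_borel_bound[OF \<phi>]) (rule that; assumption)
  obtain B\<^sub>2 where B2: "0 \<le> B\<^sub>2" "\<And>y. y \<in> Y \<Longrightarrow> cmod (\<psi> y) \<le> B\<^sub>2"
    by (rule \<psi>_bound) (rule that; assumption)
  obtain C B\<^sub>3 where B3: "\<And>g. cmod (f g) \<le> B\<^sub>3"
    by (rule Ind0_compact_support[OF f]) (rule that; assumption)
  have "cmod (unfolding_function \<rho> f \<phi> (g, y)) \<le> B * B\<^sub>3 * B\<^sub>2 * B\<^sub>1" if y: "y \<in> Y" for g y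
  proof -
    have "act g y \<in> space M" using y Y_subset act_space by blast
    moreover have "0 \<le> B" "0 \<le> B\<^sub>3"
      using order_trans[OF \<rho>0 \<rho>B] order_trans[OF norm_ge_zero B3] by auto
    ultimately show ?thesis
      using \<rho>0 \<rho>B B1 B2 B3 y
      by (auto simp: unfolding_function_def norm_mult intro!: mult_mono)
  qed
  then show "bounded (unfolding_function \<rho> f \<phi> ` (UNIV \<times> Y))"
    unfolding bounded_iff by blast
  \<comment> \<open>The weight is evaluated at the inverse, so the support in the group variable is
    the inverse of \<open>U\<close>.\<close>
  have "unfolding_function \<rho> f \<phi> (g, y) = 0" if "g \<notin> uminus ` U" for g y
  proof -
    have "- g \<notin> U" using that by (metis image_eqI minus_minus)
    then show ?thesis by (simp add: unfolding_function_def U(2))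
  qed
  then show "\<exists>L. compact L \<and> (\<forall>g y. g \<notin> L \<and> y \<in> Y \<longrightarrow> unfolding_function \<rho> f \<phi> (g, y) = 0)"
    using compact_uminus_image[OF U(1)] by blast
qed

lemma
  assumes f: "f \<in> Ind0 H \<xi>" and \<phi>: "\<phi> \<in> bounded_borel M"
  shows S_map_product_integrable: "integrable (completion \<mu>) (\<lambda>x. S_map act H Y \<psi> f x * cnj (\<phi> x))"
    and on_coset_S_adj_integrable: "integrable mHG (on_coset (\<lambda>g. f g * cnj (S_adj act \<sigma> \<psi> \<phi> g)))"
    and S_map_adjoint: "(\<integral>x. S_map act H Y \<psi> f x * cnj (\<phi> x) \<partial>completion \<mu>) =
      (\<integral>c. on_coset (\<lambda>g. f g * cnj (S_adj act \<sigma> \<psi> \<phi> g)) c \<partial>mHG)"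
proof -
  let ?T = "S_adj act \<sigma> \<psi> \<phi>" and ?S = "\<lambda>x. S_map act H Y \<psi> f x * cnj (\<phi> x)"
  obtain C B where C: "compact C" and f0: "\<And>g. g \<notin> saturation C \<Longrightarrow> f g = 0"
      and fB: "\<And>g. cmod (f g) \<le> B"
    by (rule Ind0_compact_support[OF f]) (rule that; assumption)
  obtain \<rho> :: "'g \<Rightarrow> real" and B' U where \<rho> [measurable]: "\<rho> \<in> borel_measurable borel"
      and \<rho>0: "\<And>g. 0 \<le> \<rho> g" and \<rho>B: "\<And>g. \<rho> g \<le> B'"
      and U: "compact U" "\<And>g. g \<notin> U \<Longrightarrow> \<rho> g = 0"
      and \<rho>1: "\<And>g. (\<integral>\<^sup>+h. ennreal (\<rho> (h + g)) \<partial>mH) = indicator (saturation C) g"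
    by (rule bruhat_function[OF C]) (rule that; assumption)
  let ?F = "unfolding_function \<rho> f \<phi>"
  have sum: "transverse_sum act H Y mH ?F x = ?S x" if "x \<in> space (completion \<mu>)" for x
    using that by (intro transverse_sum_unfolding_function[OF f f0 \<rho> \<rho>0 \<rho>1]) (simp_all add: space_\<mu>)
  note adm = unfolding_function_admissible[OF f \<phi> \<rho> \<rho>0 \<rho>B U]
  have F: "integrable (completion \<mu>) (transverse_sum act H Y mH ?F)"
      "(\<integral>x. transverse_sum act H Y mH ?F x \<partial>completion \<mu>) = (\<integral>g. (\<integral>y. ?F (g, y) \<partial>\<sigma>) \<partial>mG)"
    using transverse adm unfolding transverse_measure_def by blast+
  \<comment> \<open>Measurability for the completion comes along with integrability of the
    transverse sum, since the two functions agree at every point.\<close>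
  show "integrable (completion \<mu>) ?S"
    using F(1) by (subst Bochner_Integration.integrable_cong[OF refl sum[symmetric]])
  let ?u = "\<lambda>g. f g * cnj (?T g)"
  have [measurable]: "f \<in> borel_measurable borel" "?T \<in> borel_measurable borel"
    by (rule Ind0_measurable[OF f], rule S_adj_measurable[OF \<phi>])
  have u_measurable [measurable]: "?u \<in> borel_measurable borel" by measurable
  note u = u_measurable S_adj_product_invariant[OF f \<phi>]
  have u0: "?u g = 0" if "g \<notin> saturation C" for g
    using f0[OF that] by simp
  obtain B'' where B'': "\<And>g. cmod (?T g) \<le> B''"
    using S_adj_bounded[OF \<phi>] by (auto simp: bounded_iff)
  have uB: "cmod (?u g) \<le> B * B''" for g
    using fB B'' order_trans[OF norm_ge_zero fB] by (auto simp: norm_mult intro!: mult_mono)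
  show "integrable mHG (on_coset ?u)"
    by (rule integrable_on_coset[where u = ?u, OF C u u0 uB])
  have "(\<integral>x. ?S x \<partial>completion \<mu>) = (\<integral>g. (\<integral>y. ?F (g, y) \<partial>\<sigma>) \<partial>mG)"
    unfolding F(2)[symmetric] by (rule Bochner_Integration.integral_cong[OF refl sum[symmetric]])
  also have "\<dots> = (\<integral>g. of_real (\<rho> (- g)) * ?u (- g) \<partial>mG)"
  proof (rule Bochner_Integration.integral_cong[OF refl])
    fix g
    have "(\<integral>y. ?F (g, y) \<partial>\<sigma>) = (\<integral>y. (of_real (\<rho> (- g)) * f (- g)) * cnj (\<phi> (act (- (- g)) y) * cnj (\<psi> y)) \<partial>\<sigma>)"
      by (simp add: unfolding_function_def mult_ac)
    also have "\<dots> = (of_real (\<rho> (- g)) * f (- g)) * cnj (?T (- g))"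
      by (simp only: S_adj_def integral_mult_right_zero Bochner_Integration.integral_cnj)
    finally show "(\<integral>y. ?F (g, y) \<partial>\<sigma>) = of_real (\<rho> (- g)) * ?u (- g)"
      by (simp add: mult.assoc)
  qed
  also have "\<dots> = (\<integral>g. of_real (\<rho> g) * ?u g \<partial>mG)"
    by (rule integral_uminus[of "\<lambda>g. of_real (\<rho> g) * ?u g"]) measurable
  also have "\<dots> = (\<integral>c. on_coset ?u c \<partial>mHG)"
    by (rule integral_on_coset[where u = ?u, OF C \<rho> \<rho>0 \<rho>1 u u0, symmetric])
  finally show "(\<integral>x. ?S x \<partial>completion \<mu>) = (\<integral>c. on_coset ?u c \<partial>mHG)" .
qed

text \<open>The case \<phi> = 1 of the pairing.\<close>

lemma S_map_integrable:
  assumes f: "f \<in> Ind0 H \<xi>"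
  shows "integrable (completion \<mu>) (S_map act H Y \<psi> f)"
  using S_map_product_integrable[OF f, of "\<lambda>_. 1"] by (simp add: bounded_borel_def image_constant_conv)

end

text \<open>Well-definedness in (i) is rendered by three facts: the summands are constant on cosets,
  so \<open>on_coset\<close> is not an unspecified value; the sums converge almost everywhere, so
  \<open>infsum\<close> is not a default value; and the result is integrable. Elements of L^1 are
  represented by functions, hence the almost everywhere identities.\<close>

theorem theorem3:
  fixes H :: "'g::{topological_group_add, t2_space, second_countable_topology} set"
    and mG mH :: "'g measure" and mHG :: "'g set measure"
    and M \<mu> \<sigma> :: "'x measure" and act :: "'g \<Rightarrow> 'x \<Rightarrow> 'x" and Y :: "'x set"
    and \<xi> :: "'g \<Rightarrow> complex" and \<psi> :: "'x \<Rightarrow> complex"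
  assumes "locally_compact_space (euclidean :: 'g topology)"
    and "unimodular (UNIV :: 'g set)"
    and "add_subgroup H" and "closed H" and "unimodular H"
    and "haar_measure UNIV mG" and "haar_measure H mH"
    and "quotient_haar_measure H mG mH mHG"
    and "integrable_transverse_system M act H Y \<mu>"
    and "transverse_measure M act H Y \<mu> mG mH \<sigma>"
    and "unitary_character H \<xi>"
    and "eigenfunction M act H Y \<xi> \<psi>"
  shows
    "((\<forall>f\<in>Ind0 H \<xi>.
         (\<forall>x\<in>space M. \<forall>g. act g x \<in> Y \<longrightarrow>
            (\<forall>h\<in>H. f (h + g) * \<psi> (act (h + g) x) = f g * \<psi> (act g x))) \<and>
         (AE x in \<mu>. (\<lambda>c. on_coset (\<lambda>g. f g * \<psi> (act g x)) c) summable_on hitting_times act H Y x) \<and>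
         integrable (completion \<mu>) (S_map act H Y \<psi> f)) \<and>
      (\<forall>f\<^sub>1\<in>Ind0 H \<xi>. \<forall>f\<^sub>2\<in>Ind0 H \<xi>. \<forall>a b.
         AE x in \<mu>. S_map act H Y \<psi> (\<lambda>g. a * f\<^sub>1 g + b * f\<^sub>2 g) x =
           a * S_map act H Y \<psi> f\<^sub>1 x + b * S_map act H Y \<psi> f\<^sub>2 x) \<and>
      (\<forall>f\<in>Ind0 H \<xi>. \<forall>k.
         AE x in \<mu>. S_map act H Y \<psi> (\<lambda>g. f (g + k)) x = S_map act H Y \<psi> f (act (- k) x))) \<and>
     (\<forall>\<phi>\<in>bounded_borel M.
        (\<forall>g. integrable \<sigma> (\<lambda>y. \<phi> (act (- g) y) * cnj (\<psi> y))) \<and>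
        S_adj act \<sigma> \<psi> \<phi> \<in> borel_measurable borel \<and> bounded (range (S_adj act \<sigma> \<psi> \<phi>))) \<and>
     (\<forall>f\<in>Ind0 H \<xi>. \<forall>\<phi>\<in>bounded_borel M.
        (\<forall>h\<in>H. \<forall>g. f (h + g) * cnj (S_adj act \<sigma> \<psi> \<phi> (h + g)) = f g * cnj (S_adj act \<sigma> \<psi> \<phi> g)) \<and>
        integrable mHG (on_coset (\<lambda>g. f g * cnj (S_adj act \<sigma> \<psi> \<phi> g))) \<and>
        (\<integral>x. S_map act H Y \<psi> f x * cnj (\<phi> x) \<partial>completion \<mu>) =
          (\<integral>c. on_coset (\<lambda>g. f g * cnj (S_adj act \<sigma> \<psi> \<phi> g)) c \<partial>mHG))"
proof -
  interpret transverse_eigenfunction H mG mH mHG M \<mu> \<sigma> act Y \<xi> \<psi>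
    using assms
    by (intro transverse_eigenfunction.intro homogeneous_space.intro haar_subgroup.intro
        homogeneous_space_axioms.intro transverse_eigenfunction_axioms.intro)
      (simp_all add: add_subgroup_def)
  have "f (h + g) * \<psi> (act (h + g) x) = f g * \<psi> (act g x)"
    if "f \<in> Ind0 H \<xi>" "x \<in> space M" "act g x \<in> Y" "h \<in> H" for f x g h
    by (rule summand_invariant[of f, OF Ind0_equivariant[OF that(1)] that(2-4)])
  moreover have "AE x in \<mu>. S_map act H Y \<psi> (\<lambda>g. f (g + k)) x = S_map act H Y \<psi> f (act (- k) x)"
    if "f \<in> Ind0 H \<xi>" for f k
    using S_map_translate[OF that] by (intro AE_I2) (simp add: space_\<mu>)
  ultimately show ?thesis
    using AE_summable S_map_integrable S_map_linear
      S_adj_integrable S_adj_measurable S_adj_bounded S_adj_product_invariant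
      on_coset_S_adj_integrable S_map_adjoint
    by (intro conjI ballI allI impI)
qed

end
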